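(* Let $(\bar x,\bar y)$ be a local minimizer of the bilevel program (BP). Suppose that the value function $V$ is directionally Lipschitz continuous and directionally differentiable at $\bar x$ in direction $u$ and $(u,v)\in C(\bar x,\bar y)$. Moreover suppose that the directional quasi-normality holds at $(\bar x,\bar y)$ in direction $(u,v)$, i.e., there exists no nonzero vector $(\alpha,\nu_g,\nu_G)\in\mathbb R^{1+p+q}_+$ such that $$0\in\alpha\nabla f(\bar x,\bar y)-\alpha\,\partial^cV(\bar x;u)\times\{0\}+\nabla g(\bar x,\bar y)^T\nu_g+\nabla G(\bar x,\bar y)^T\nu_G,$$ $$\nu_g\perp g(\bar x,\bar y),\ \nu_g\perp\nabla g(\bar x,\bar y)(u,v),\ \nu_G\perp G(\bar x,\bar y),\ \nu_G\perp\nabla G(\bar x,\bar y)(u,v),$$ and there exist sequences $t_k\downarrow0$, $(u^k,v^k)\to(u,v)$ such that $$\alpha\big(f(\bar x+t_ku^k,\bar y+t_kv^k)-V(\bar x+t_ku^k)\big)>0\ \text{ if }\alpha>0,$$ $$g_i(\bar x+t_ku^k,\bar y+t_kv^k)>0\ \text{ if }(\nu_g)_i>0,\ i\in I_g,\qquad G_i(\bar x+t_ku^k,\bar y+t_kv^k)>0\ \text{ if }(\nu_G)_i>0,\ i\in I_G.$$ Then the directional KKT condition holds, i.e. there exists $(\lambda_V,\lambda_g,\lambda_G)$ with $$0\in\nabla F(\bar x,\bar y)+\lambda_V\nabla f(\bar x,\bar y)+\lambda_V\,\partial(-V)(\bar x;u)\times\{0\}+\nabla g(\bar x,\bar y)^T\lambda_g+\nabla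 G(\bar x,\bar y)^T\lambda_G,$$ $$\lambda_V\ge0,\ 0\le\lambda_g\perp g(\bar x,\bar y),\ \lambda_g\perp\nabla g(\bar x,\bar y)(u,v),\ 0\le\lambda_G\perp G(\bar x,\bar y),\ \lambda_G\perp\nabla G(\bar x,\bar y)(u,v).$$ Moreover, there exists $(\lambda_V,\lambda_g,\lambda_G)$ satisfying the same sign and orthogonality conditions and $$0\in\nabla F(\bar x,\bar y)+\lambda_V\nabla f(\bar x,\bar y)-\lambda_V\,\partial^cV(\bar x;u)\times\{0\}+\nabla g(\bar x,\bar y)^T\lambda_g+\nabla G(\bar x,\bar y)^T\lambda_G.$$
   Context: Let $F,f:\mathbb R^n\times\mathbb R^m\to\mathbb R$, $G:\mathbb R^n\times\mathbb R^m\to\mathbb R^q$, $g:\mathbb R^n\times\mathbb R^m\to\mathbb R^p$ be continuously differentiable. Let $S(x)$ be the set of optimal solutions of the lower level problem $\min_y f(x,y)$ s.t. $g(x,y)\le0$, and $V(x)=\inf_y\{f(x,y):g(x,y)\le0\}$ its value function. (BP): $\min_{x,y}F(x,y)$ s.t. $y\in S(x)$, $G(x,y)\le0$. $\mathbb B$ is the open unit ball. For a direction $d$ and $\epsilon,\delta>0$: $\mathcal V_{\epsilon,\delta}(d):=\{z\in\epsilon\mathbb B : \big\|\,\|d\|z-\|z\|d\,\big\|\le\delta\|z\|\|d\|\}$. $V'(\bar x;u)=\lim_{t\downarrow0}(V(\bar x+tu)-V(\bar x))/t$; $V$ is directionally differentiable at $\bar x$ in direction $u$ if this limit exists. $V$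 is directionally Lipschitz continuous at $\bar x$ in direction $u$ if there are $L,\epsilon,\delta>0$ such that $V$ is finite and $|V(x)-V(x')|\le L\|x-x'\|$ for all $x,x'\in\bar x+\mathcal V_{\epsilon,\delta}(u)$. $I_g=\{i:g_i(\bar x,\bar y)=0\}$, $I_G=\{i:G_i(\bar x,\bar y)=0\}$. $(u,v)\in C(\bar x,\bar y)$ (critical cone) means $\nabla f(\bar x,\bar y)(u,v)\le V'(\bar x;u)$, $\nabla g_i(\bar x,\bar y)(u,v)\le0$ for $i\in I_g$, $\nabla G_i(\bar x,\bar y)(u,v)\le0$ for $i\in I_G$, and $\nabla F(\bar x,\bar y)(u,v)\le0$. Regular subdifferential: $\widehat\partial\psi(\bar x)=\{\xi:\psi(x)\ge\psi(\bar x)+\langle\xi,x-\bar x\rangle+o(\|x-\bar x\|)\}$. Directional limiting subdifferential: $\partial\psi(\bar x;u)=\{\xi:\exists t_k\downarrow0,u^k\to u,\xi^k\to\xi\text{ with }\psi(\bar x+t_ku^k)\to\psi(\bar x),\ \xi^k\in\widehat\partial\psi(\bar x+t_ku^k)\}$. Directional Clarke subdifferential: $\partial^c\psi(\bar x;u)=\mathrm{co}\,\partial\psi(\bar x;u)$. *)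

theory Defs
  imports "HOL-Analysis.Analysis" "HOL-Library.Landau_Symbols"
begin

section \<open>Smooth data\<close>

definition cont_differentiable ::
    "('a::real_normed_vector \<Rightarrow> 'b::real_normed_vector) \<Rightarrow> bool" where
  "cont_differentiable h \<longleftrightarrow>
     (\<exists>h'. (\<forall>z. (h has_derivative blinfun_apply (h' z)) (at z)) \<and> continuous_on UNIV h')"

definition gradient :: "('a::real_inner \<Rightarrow> real) \<Rightarrow> 'a \<Rightarrow> 'a" where
  "gradient h z = (THE D. GDERIV h z :> D)"

text \<open>
  The Jacobian of a vector-valued map, as a linear map (the library constant \<^const>\<open>jacobian\<close>
  is a matrix and does not apply to product domains); its transpose is \<^const>\<open>adjoint\<close>.
\<close>

abbreviation deriv_map ::
    "('a::real_normed_vector \<Rightarrow> 'b::real_normed_vector) \<Rightarrow> 'a \<Rightarrow> 'a \<Rightarrow> 'b" where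
  "deriv_map h z \<equiv> frechet_derivative h (at z)"


section \<open>The bilevel program\<close>

text \<open>Inequalities between vectors in \<^typ>\<open>real ^ 'p\<close> are componentwise.\<close>

definition lower_solutions ::
    "('a \<times> 'b \<Rightarrow> real) \<Rightarrow> ('a \<times> 'b \<Rightarrow> real ^ 'p) \<Rightarrow> 'a \<Rightarrow> 'b set" where
  "lower_solutions f g x = {y. g (x, y) \<le> 0 \<and> (\<forall>y'. g (x, y') \<le> 0 \<longrightarrow> f (x, y) \<le> f (x, y'))}"

text \<open>Extended-real valued: \<open>\<infinity>\<close> if the lower level problem is infeasible, \<open>-\<infinity>\<close> if it is unbounded.\<close>

definition value_function ::
    "('a \<times> 'b \<Rightarrow> real) \<Rightarrow> ('a \<times> 'b \<Rightarrow> real ^ 'p) \<Rightarrow> 'a \<Rightarrow> ereal" where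
  "value_function f g x = (INF y\<in>{y. g (x, y) \<le> 0}. ereal (f (x, y)))"

definition BP_feasible ::
    "('a \<times> 'b \<Rightarrow> real) \<Rightarrow> ('a \<times> 'b \<Rightarrow> real ^ 'p) \<Rightarrow> ('a \<times> 'b \<Rightarrow> real ^ 'q) \<Rightarrow> ('a \<times> 'b) set" where
  "BP_feasible f g G = {(x, y). y \<in> lower_solutions f g x \<and> G (x, y) \<le> 0}"

definition BP_local_minimizer ::
    "('a::metric_space \<times> 'b::metric_space \<Rightarrow> real) \<Rightarrow> ('a \<times> 'b \<Rightarrow> real) \<Rightarrow>
     ('a \<times> 'b \<Rightarrow> real ^ 'p) \<Rightarrow> ('a \<times> 'b \<Rightarrow> real ^ 'q) \<Rightarrow> 'a \<times> 'b \<Rightarrow> bool" where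
  "BP_local_minimizer F f g G z \<longleftrightarrow> z \<in> BP_feasible f g G \<and>
     (\<exists>\<epsilon>>0. \<forall>w \<in> BP_feasible f g G \<inter> ball z \<epsilon>. F z \<le> F w)"


section \<open>Directional notions of variational analysis\<close>

definition dir_nbhd :: "real \<Rightarrow> real \<Rightarrow> 'a::real_normed_vector \<Rightarrow> 'a set" where
  "dir_nbhd \<epsilon> \<delta> d =
     {z \<in> ball 0 \<epsilon>. norm (norm d *\<^sub>R z - norm z *\<^sub>R d) \<le> \<delta> * norm z * norm d}"

text \<open>
  The limits below are taken in \<^typ>\<open>ereal\<close>; the difference quotients are only meaningful
  where \<open>\<psi> x\<close> is finite, which directional Lipschitz continuity at \<open>x\<close> guarantees.
\<close>

definition dir_quotient :: "('a::real_normed_vector \<Rightarrow> ereal) \<Rightarrow> 'a \<Rightarrow> 'a \<Rightarrow> real \<Rightarrow> ereal" where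
  "dir_quotient \<psi> x u t = (\<psi> (x + t *\<^sub>R u) - \<psi> x) / ereal t"

definition dir_differentiable :: "('a::real_normed_vector \<Rightarrow> ereal) \<Rightarrow> 'a \<Rightarrow> 'a \<Rightarrow> bool" where
  "dir_differentiable \<psi> x u \<longleftrightarrow> (\<exists>l. (dir_quotient \<psi> x u \<longlongrightarrow> l) (at_right 0))"

definition dir_derivative :: "('a::real_normed_vector \<Rightarrow> ereal) \<Rightarrow> 'a \<Rightarrow> 'a \<Rightarrow> ereal" where
  "dir_derivative \<psi> x u = Lim (at_right 0) (dir_quotient \<psi> x u)"

definition dir_Lipschitz :: "('a::real_normed_vector \<Rightarrow> ereal) \<Rightarrow> 'a \<Rightarrow> 'a \<Rightarrow> bool" where
  "dir_Lipschitz \<psi> x u \<longleftrightarrow>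
     (\<exists>L>0. \<exists>\<epsilon>>0. \<exists>\<delta>>0.
        (\<forall>a \<in> (+) x ` dir_nbhd \<epsilon> \<delta> u. \<bar>\<psi> a\<bar> \<noteq> \<infinity>) \<and>
        (\<forall>a \<in> (+) x ` dir_nbhd \<epsilon> \<delta> u. \<forall>b \<in> (+) x ` dir_nbhd \<epsilon> \<delta> u.
           \<bar>\<psi> a - \<psi> b\<bar> \<le> ereal (L * norm (a - b))))"

text \<open>Empty, by convention, where the function is not finite.\<close>

definition regular_subdiff :: "('a::real_inner \<Rightarrow> ereal) \<Rightarrow> 'a \<Rightarrow> 'a set" where
  "regular_subdiff \<psi> x =
     {\<xi>. \<bar>\<psi> x\<bar> \<noteq> \<infinity> \<and>
         (\<exists>r \<in> o[at x](\<lambda>z. norm (z - x)).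
            \<forall>\<^sub>F z in at x. \<psi> z \<ge> \<psi> x + ereal (\<xi> \<bullet> (z - x) + r z))}"

definition dir_limiting_subdiff :: "('a::real_inner \<Rightarrow> ereal) \<Rightarrow> 'a \<Rightarrow> 'a \<Rightarrow> 'a set" where
  "dir_limiting_subdiff \<psi> x u =
     {\<xi>. \<exists>(t :: nat \<Rightarrow> real) us \<xi>s.
           (\<forall>k. t k > 0) \<and> t \<longlonglongrightarrow> 0 \<and> us \<longlonglongrightarrow> u \<and> \<xi>s \<longlonglongrightarrow> \<xi> \<and>
           (\<lambda>k. \<psi> (x + t k *\<^sub>R us k)) \<longlonglongrightarrow> \<psi> x \<and>
           (\<forall>k. \<xi>s k \<in> regular_subdiff \<psi> (x + t k *\<^sub>R us k))}"

definition dir_Clarke_subdiff :: "('a::real_inner \<Rightarrow> ereal) \<Rightarrow> 'a \<Rightarrow> 'a \<Rightarrow> 'a set" where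
  "dir_Clarke_subdiff \<psi> x u = convex hull (dir_limiting_subdiff \<psi> x u)"


section \<open>Critical cone and directional quasi-normality\<close>

definition active :: "('a \<Rightarrow> real ^ 'p) \<Rightarrow> 'a \<Rightarrow> 'p set" where
  "active h z = {i. h z $ i = 0}"

definition critical_cone ::
    "('a::euclidean_space \<times> 'b::euclidean_space \<Rightarrow> real) \<Rightarrow> ('a \<times> 'b \<Rightarrow> real) \<Rightarrow>
     ('a \<times> 'b \<Rightarrow> real ^ 'p) \<Rightarrow> ('a \<times> 'b \<Rightarrow> real ^ 'q) \<Rightarrow> 'a \<times> 'b \<Rightarrow> ('a \<times> 'b) set" where
  "critical_cone F f g G z =
     {(u, v).
        ereal (gradient f z \<bullet> (u, v)) \<le> dir_derivative (value_function f g) (fst z) u \<and>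
        (\<forall>i \<in> active g z. deriv_map g z (u, v) $ i \<le> 0) \<and>
        (\<forall>i \<in> active G z. deriv_map G z (u, v) $ i \<le> 0) \<and>
        gradient F z \<bullet> (u, v) \<le> 0}"

definition dir_quasi_normality ::
    "('a::euclidean_space \<times> 'b::euclidean_space \<Rightarrow> real) \<Rightarrow>
     ('a \<times> 'b \<Rightarrow> real ^ 'p) \<Rightarrow> ('a \<times> 'b \<Rightarrow> real ^ 'q) \<Rightarrow> 'a \<times> 'b \<Rightarrow> 'a \<times> 'b \<Rightarrow> bool" where
  "dir_quasi_normality f g G z w \<longleftrightarrow>
     \<not> (\<exists>(\<alpha> :: real) (\<nu>g :: real ^ 'p) (\<nu>G :: real ^ 'q).
          (\<alpha>, \<nu>g, \<nu>G) \<noteq> 0 \<and> 0 \<le> \<alpha> \<and> 0 \<le> \<nu>g \<and> 0 \<le> \<nu>G \<and>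
          0 \<in> {\<alpha> *\<^sub>R gradient f z - \<alpha> *\<^sub>R (\<zeta>, 0)
                + adjoint (deriv_map g z) \<nu>g + adjoint (deriv_map G z) \<nu>G
               | \<zeta>. \<zeta> \<in> dir_Clarke_subdiff (value_function f g) (fst z) (fst w)} \<and>
          orthogonal \<nu>g (g z) \<and> orthogonal \<nu>g (deriv_map g z w) \<and>
          orthogonal \<nu>G (G z) \<and> orthogonal \<nu>G (deriv_map G z w) \<and>
          (\<exists>(t :: nat \<Rightarrow> real) (ws :: nat \<Rightarrow> 'a \<times> 'b).
             (\<forall>k. t k > 0) \<and> t \<longlonglongrightarrow> 0 \<and> ws \<longlonglongrightarrow> w \<and>
             (\<forall>k. (\<alpha> > 0 \<longrightarrow>
                     ereal \<alpha> * (ereal (f (z + t k *\<^sub>R ws k))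
                        - value_function f g (fst (z + t k *\<^sub>R ws k))) > 0) \<and>
                  (\<forall>i \<in> active g z. \<nu>g $ i > 0 \<longrightarrow> g (z + t k *\<^sub>R ws k) $ i > 0) \<and>
                  (\<forall>i \<in> active G z. \<nu>G $ i > 0 \<longrightarrow> G (z + t k *\<^sub>R ws k) $ i > 0))))"

end

theory Submission
  imports Defs
begin

text \<open>
  Near \<open>z = (xb, yb)\<close> the bilevel program minimizes \<open>F\<close> subject to \<open>f - V \<le> 0\<close>, \<open>g \<le> 0\<close>, \<open>G \<le> 0\<close>.
  Let \<open>N\<close> be the Euclidean norm of the positive part of these constraints and \<open>w = (u, v)\<close>.
  Either \<open>z\<close> minimizes \<open>\<epsilon> F + N\<close> for some \<open>\<epsilon> > 0\<close> over a conical neighbourhood of \<open>z\<close> in direction \<open>w\<close>,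
  or there are points \<open>y\<close> tending to \<open>z\<close> in direction \<open>w\<close> with \<open>\<epsilon> F y + N y < \<epsilon> F z\<close> and \<open>\<epsilon>\<close> tending to \<open>0\<close>.
  In both cases adding \<open>\<bar>y - y0\<bar>\<^sup>2 / t\<close>, with \<open>y0 = z + t w\<close> or the given point, produces nearby local
  minimizers at distance \<open>o(t)\<close> from \<open>y0\<close>, so the additional gradients vanish in the limit.
  In the first case \<open>N\<close> is replaced by \<open>sqrt (t\<^sup>4 + N\<^sup>2)\<close>, criticality of \<open>w\<close> gives \<open>N (z + t w) = o(t)\<close>, and
  the limit of the stationarity conditions, divided by \<open>\<epsilon>\<close>, is the KKT condition.
  In the second case the minimizers are infeasible, the multipliers have norm \<open>1\<close> and are positive only for
  violated constraints, so the limit contradicts quasi-normality.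

  The passage from \<open>\<partial>(-V)(xb; u)\<close> to \<open>-\<partial>\<^sup>cV(xb; u)\<close> separates a point from the compact set \<open>\<partial>\<^sup>cV(xb; u)\<close> and
  contradicts an approximate mean value inequality.
\<close>

section \<open>Directional neighbourhoods and regular subgradients\<close>

text \<open>In contrast to \<open>dir_nbhd\<close> in general, this set is open, and each of its
  points \<open>y\<close> comes with a step length \<open>t\<close> for which
  \<open>(y - x) / t\<close> lies within \<open>\<eta>\<close> of \<open>d\<close>. For
  \<open>d = 0\<close> and positive radii it is a ball about \<open>x\<close>.\<close>

definition cone_nbhd :: "'a::real_normed_vector \<Rightarrow> 'a \<Rightarrow> real \<Rightarrow> real \<Rightarrow> 'a set" where
  "cone_nbhd x d \<tau> \<eta> = (\<Union>t\<in>{0<..<\<tau>}. ball (x + t *\<^sub>R d) (t * \<eta>))"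

lemma cone_nbhdI:
  "0 < t \<Longrightarrow> t < \<tau> \<Longrightarrow> dist (x + t *\<^sub>R d) y < t * \<eta> \<Longrightarrow> y \<in> cone_nbhd x d \<tau> \<eta>"
  by (auto simp: cone_nbhd_def)

lemma cone_nbhdE:
  assumes "y \<in> cone_nbhd x d \<tau> \<eta>"
  obtains t where "0 < t" "t < \<tau>" "dist (x + t *\<^sub>R d) y < t * \<eta>"
  using assms by (auto simp: cone_nbhd_def)

lemma open_cone_nbhd: "open (cone_nbhd x d \<tau> \<eta>)"
  by (auto simp: cone_nbhd_def)

lemma cone_nbhd_mono:
  assumes "\<tau> \<le> \<tau>'" "\<eta> \<le> \<eta>'"
  shows "cone_nbhd x d \<tau> \<eta> \<subseteq> cone_nbhd x d \<tau>' \<eta>'"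
proof
  fix y assume "y \<in> cone_nbhd x d \<tau> \<eta>"
  then obtain t where t: "0 < t" "t < \<tau>" "dist (x + t *\<^sub>R d) y < t * \<eta>"
    by (rule cone_nbhdE)
  have "t * \<eta> \<le> t * \<eta>'"
    using t assms by (intro mult_left_mono) auto
  with t have "dist (x + t *\<^sub>R d) y < t * \<eta>'" by linarith
  with t assms show "y \<in> cone_nbhd x d \<tau>' \<eta>'"
    by (intro cone_nbhdI[of t]) auto
qed

lemma cone_nbhd_direction:
  assumes "0 < t" "dist (x + t *\<^sub>R d) y < t * \<eta>"
  shows "norm ((1 / t) *\<^sub>R (y - x) - d) < \<eta>"
proof -
  have "(1 / t) *\<^sub>R (y - x) - d = (1 / t) *\<^sub>R (y - (x + t *\<^sub>R d))"
    using assms by (simp add: algebra_simps)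
  then have "norm ((1 / t) *\<^sub>R (y - x) - d) = dist (x + t *\<^sub>R d) y / t"
    using assms by (simp add: dist_norm norm_minus_commute)
  with assms show ?thesis
    by (simp add: divide_less_eq mult.commute)
qed

lemma cone_nbhd_dist:
  assumes "0 < t" "dist (x + t *\<^sub>R d) y < t * \<eta>"
  shows "dist x y < t * (norm d + \<eta>)"
proof -
  have "dist x y \<le> dist x (x + t *\<^sub>R d) + dist (x + t *\<^sub>R d) y"
    by (rule dist_triangle)
  also have "dist x (x + t *\<^sub>R d) = t * norm d"
    using assms by (simp add: dist_norm)
  finally show ?thesis
    using assms by (simp add: algebra_simps)
qed

lemma cone_nbhd_fst:
  assumes "y \<in> cone_nbhd z w \<tau> \<eta>"
  shows "fst y \<in> cone_nbhd (fst z) (fst w) \<tau> \<eta>"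
proof -
  obtain t where t: "0 < t" "t < \<tau>" "dist (z + t *\<^sub>R w) y < t * \<eta>"
    using assms by (rule cone_nbhdE)
  then show ?thesis
    using dist_fst_le[of "z + t *\<^sub>R w" y] by (intro cone_nbhdI[of t]) auto
qed

text \<open>With \<open>d = y - x\<close>, the vector measured in \<open>dir_nbhd\<close> has norm
  at most \<open>2 * norm (d - t *\<^sub>R u) * norm u\<close>, since replacing \<open>d\<close> by
  \<open>t *\<^sub>R u\<close> turns it into 0 and costs the same error in each of its two
  terms.\<close>

lemma cone_subset_dir_nbhd:
  fixes u :: "'a::real_normed_vector"
  assumes "\<epsilon> > 0" "\<delta> > 0"
  obtains \<tau> \<eta> where "\<tau> > 0" "\<eta> > 0" "cone_nbhd x u \<tau> \<eta> \<subseteq> (+) x ` dir_nbhd \<epsilon> \<delta> u"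
proof -
  \<comment> \<open>For nonzero \<open>u\<close> this solves
    \<open>(2 + \<delta>) * \<eta> = \<delta> * norm u\<close>. Twice an error below
    \<open>t * \<eta>\<close> is then at most \<open>\<delta>\<close> times
    \<open>t * norm u\<close> minus the error, and the latter is a lower bound for
    \<open>norm d\<close>.\<close>
  define \<eta> where "\<eta> = (if u = 0 then 1 else \<delta> * norm u / (2 + \<delta>))"
  have \<eta>: "\<eta> > 0" using assms by (auto simp: \<eta>_def)
  define \<tau> where "\<tau> = \<epsilon> / (norm u + \<eta>)"
  have pos: "norm u + \<eta> > 0" using \<eta> by (simp add: add_nonneg_pos)
  have \<tau>: "\<tau> > 0" using assms pos by (simp add: \<tau>_def)
  have "cone_nbhd x u \<tau> \<eta> \<subseteq> (+) x ` dir_nbhd \<epsilon> \<delta> u"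
  proof
    fix y assume "y \<in> cone_nbhd x u \<tau> \<eta>"
    then obtain t where t: "0 < t" "t < \<tau>" "dist (x + t *\<^sub>R u) y < t * \<eta>"
      by (rule cone_nbhdE)
    define d where "d = y - x"
    have e: "norm (d - t *\<^sub>R u) < t * \<eta>"
      using t(3) by (simp add: d_def dist_norm norm_minus_commute algebra_simps)
    have "norm d < t * (norm u + \<eta>)"
      using cone_nbhd_dist[OF t(1,3)] by (simp add: d_def dist_norm norm_minus_commute)
    also have "\<dots> \<le> \<epsilon>"
      using t pos by (simp add: \<tau>_def field_simps)
    finally have "norm d < \<epsilon>" .
    moreover have "norm (norm u *\<^sub>R d - norm d *\<^sub>R u) \<le> \<delta> * norm d * norm u"
    proof (cases "u = 0")
      case False
      have low: "norm d \<ge> t * norm u - norm (d - t *\<^sub>R u)"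
        using norm_triangle_ineq2[of "t *\<^sub>R u" "t *\<^sub>R u - d"] t(1)
        by (simp add: norm_minus_commute)
      have up: "\<bar>t * norm u - norm d\<bar> \<le> norm (d - t *\<^sub>R u)"
        using norm_triangle_ineq3[of "t *\<^sub>R u" d] t(1) by (simp add: norm_minus_commute)
      have "norm u *\<^sub>R d - norm d *\<^sub>R u
          = norm u *\<^sub>R (d - t *\<^sub>R u) + (t * norm u - norm d) *\<^sub>R u"
        by (simp add: algebra_simps)
      then have "norm (norm u *\<^sub>R d - norm d *\<^sub>R u)
          \<le> norm u * norm (d - t *\<^sub>R u) + \<bar>t * norm u - norm d\<bar> * norm u"
        using norm_triangle_ineq[of "norm u *\<^sub>R (d - t *\<^sub>R u)" "(t * norm u - norm d) *\<^sub>R u"]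
        by simp
      also have "\<dots> \<le> norm u * norm (d - t *\<^sub>R u) + norm (d - t *\<^sub>R u) * norm u"
        using up by (intro add_mono mult_right_mono) auto
      also have "\<dots> = (2 * norm (d - t *\<^sub>R u)) * norm u" by simp
      also have "\<dots> \<le> (\<delta> * norm d) * norm u"
      proof (intro mult_right_mono)
        have eq: "(2 + \<delta>) * \<eta> = \<delta> * norm u"
          using False assms by (simp add: \<eta>_def)
        have "(2 + \<delta>) * norm (d - t *\<^sub>R u) \<le> (2 + \<delta>) * (t * \<eta>)"
          using e assms by (intro mult_left_mono) auto
        also have "\<dots> = t * ((2 + \<delta>) * \<eta>)" by (simp add: algebra_simps)
        also have "\<dots> = \<delta> * (t * norm u)" by (simp add: eq)
        finally have "2 * norm (d - t *\<^sub>R u) \<le> \<delta> * (t * norm u - norm (d - t *\<^sub>R u))"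
          by (simp add: algebra_simps)
        also have "\<dots> \<le> \<delta> * norm d"
          using low assms by (intro mult_left_mono) auto
        finally show "2 * norm (d - t *\<^sub>R u) \<le> \<delta> * norm d" .
      qed auto
      finally show ?thesis .
    qed auto
    ultimately have "d \<in> dir_nbhd \<epsilon> \<delta> u" by (simp add: dir_nbhd_def)
    then show "y \<in> (+) x ` dir_nbhd \<epsilon> \<delta> u"
      by (intro image_eqI[of _ _ d]) (simp add: d_def)
  qed
  with \<tau> \<eta> show ?thesis by (rule that)
qed

text \<open>Replaces the extended-real function by a real representative. The base point is inserted
  because the open cone need not contain it, while 0 belongs to every \<open>dir_nbhd\<close> of
  positive radius.\<close>

lemma dir_LipschitzE:
  fixes \<psi> :: "'a::real_normed_vector \<Rightarrow> ereal"
  assumes "dir_Lipschitz \<psi> x u"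
  obtains r L \<tau> \<eta> where "\<tau> > 0" "\<eta> > 0"
    "\<And>a. a \<in> insert x (cone_nbhd x u \<tau> \<eta>) \<Longrightarrow> \<psi> a = ereal (r a)"
    "L-lipschitz_on (insert x (cone_nbhd x u \<tau> \<eta>)) r"
proof -
  obtain L \<epsilon> \<delta> where L: "L > 0" "\<epsilon> > 0" "\<delta> > 0"
    and fin: "\<forall>a \<in> (+) x ` dir_nbhd \<epsilon> \<delta> u. \<bar>\<psi> a\<bar> \<noteq> \<infinity>"
    and lip: "\<forall>a \<in> (+) x ` dir_nbhd \<epsilon> \<delta> u. \<forall>b \<in> (+) x ` dir_nbhd \<epsilon> \<delta> u.
       \<bar>\<psi> a - \<psi> b\<bar> \<le> ereal (L * norm (a - b))"
    using assms[unfolded dir_Lipschitz_def] by (elim exE conjE) (rule that)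
  obtain \<tau> \<eta> where \<tau>: "\<tau> > 0" "\<eta> > 0" "cone_nbhd x u \<tau> \<eta> \<subseteq> (+) x ` dir_nbhd \<epsilon> \<delta> u"
    using cone_subset_dir_nbhd[OF L(2,3)] by blast
  have "x \<in> (+) x ` dir_nbhd \<epsilon> \<delta> u"
    using L by (intro image_eqI[of _ _ 0]) (auto simp: dir_nbhd_def)
  with \<tau>(3) have sub: "insert x (cone_nbhd x u \<tau> \<eta>) \<subseteq> (+) x ` dir_nbhd \<epsilon> \<delta> u" by auto
  define r where "r = (\<lambda>a. real_of_ereal (\<psi> a))"
  have r: "\<psi> a = ereal (r a)" if "a \<in> insert x (cone_nbhd x u \<tau> \<eta>)" for a
    using bspec[OF fin, of a] that sub by (auto simp: r_def ereal_real')
  have "L-lipschitz_on (insert x (cone_nbhd x u \<tau> \<eta>)) r"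
  proof (rule lipschitz_onI)
    fix a b assume ab: "a \<in> insert x (cone_nbhd x u \<tau> \<eta>)" "b \<in> insert x (cone_nbhd x u \<tau> \<eta>)"
    then have "\<bar>\<psi> a - \<psi> b\<bar> \<le> ereal (L * norm (a - b))" using sub by (intro lip[rule_format]; blast)
    then show "dist (r a) (r b) \<le> L * dist a b"
      by (simp add: r[OF ab(1)] r[OF ab(2)] dist_norm)
  qed (use L in simp)
  with \<tau>(1,2) r show ?thesis by (rule that)
qed

section \<open>Regular subgradients of real-valued functions\<close>

text \<open>The epsilon form of a regular subgradient, free of extended reals and of the Landau
  remainder.\<close>

definition has_regular_subgradient :: "('a::real_inner \<Rightarrow> real) \<Rightarrow> 'a \<Rightarrow> 'a \<Rightarrow> bool" where
  "has_regular_subgradient r \<xi> x \<longleftrightarrow>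
     (\<forall>e>0. \<forall>\<^sub>F y in nhds x. r x + \<xi> \<bullet> (y - x) - e * norm (y - x) \<le> r y)"

lemma has_regular_subgradientD:
  "has_regular_subgradient r \<xi> x \<Longrightarrow> e > 0 \<Longrightarrow>
     \<forall>\<^sub>F y in nhds x. r x + \<xi> \<bullet> (y - x) - e * norm (y - x) \<le> r y"
  by (simp add: has_regular_subgradient_def)

lemma regular_subdiff_iff:
  fixes x :: "'a::real_inner"
  assumes ev: "\<forall>\<^sub>F y in nhds x. \<psi> y = ereal (r y)"
  shows "\<xi> \<in> regular_subdiff \<psi> x \<longleftrightarrow> has_regular_subgradient r \<xi> x"
proof
  have x: "\<psi> x = ereal (r x)" using ev by (rule eventually_nhds_x_imp_x)
  assume "\<xi> \<in> regular_subdiff \<psi> x"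
  then obtain \<rho> where \<rho>: "\<rho> \<in> o[at x](\<lambda>z. norm (z - x))"
    and le: "\<forall>\<^sub>F z in at x. \<psi> x + ereal (\<xi> \<bullet> (z - x) + \<rho> z) \<le> \<psi> z"
    by (auto simp: regular_subdiff_def)
  show "has_regular_subgradient r \<xi> x"
    unfolding has_regular_subgradient_def
  proof (intro allI impI)
    fix e :: real assume "e > 0"
    with \<rho> have "\<forall>\<^sub>F z in at x. norm (\<rho> z) \<le> e * norm (norm (z - x))"
      by (rule landau_o.smallD)
    moreover have "\<forall>\<^sub>F z in at x. \<psi> z = ereal (r z)"
      using ev by (auto simp: eventually_at_filter elim: eventually_mono)
    ultimately have "\<forall>\<^sub>F z in at x. r x + \<xi> \<bullet> (z - x) - e * norm (z - x) \<le> r z"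
      using le by eventually_elim (auto simp: x)
    then show "\<forall>\<^sub>F z in nhds x. r x + \<xi> \<bullet> (z - x) - e * norm (z - x) \<le> r z"
      by (simp add: eventually_nhds_conv_at)
  qed
next
  have x: "\<psi> x = ereal (r x)" using ev by (rule eventually_nhds_x_imp_x)
  assume sub: "has_regular_subgradient r \<xi> x"
  \<comment> \<open>Only the negative part of the linearization error has to be small, so this part
    serves as the remainder.\<close>
  define \<rho> where "\<rho> z = min 0 (r z - r x - \<xi> \<bullet> (z - x))" for z
  have "\<rho> \<in> o[at x](\<lambda>z. norm (z - x))"
  proof (rule landau_o.smallI)
    fix e :: real assume "e > 0"
    with sub have "\<forall>\<^sub>F z in at x. r x + \<xi> \<bullet> (z - x) - e * norm (z - x) \<le> r z"
      by (auto simp: has_regular_subgradient_def eventually_nhds_conv_at)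
    then show "\<forall>\<^sub>F z in at x. norm (\<rho> z) \<le> e * norm (norm (z - x))"
      by eventually_elim (use \<open>e > 0\<close> in \<open>auto simp: \<rho>_def min_def\<close>)
  qed
  moreover have "\<forall>\<^sub>F z in at x. \<psi> z = ereal (r z)"
    using ev by (auto simp: eventually_at_filter elim: eventually_mono)
  then have "\<forall>\<^sub>F z in at x. \<psi> x + ereal (\<xi> \<bullet> (z - x) + \<rho> z) \<le> \<psi> z"
    by eventually_elim (auto simp: \<rho>_def x)
  ultimately show "\<xi> \<in> regular_subdiff \<psi> x"
    by (auto simp: regular_subdiff_def x)
qed

lemma eventually_nhds_along:
  fixes x d :: "'a::real_normed_vector"
  assumes "eventually P (nhds x)"
  shows "\<forall>\<^sub>F s in at_right 0. P (x + s *\<^sub>R d)"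
proof -
  have "((\<lambda>s. x + s *\<^sub>R d) \<longlongrightarrow> x + 0 *\<^sub>R d) (at_right 0)"
    by (intro tendsto_intros)
  with assms show ?thesis
    by (simp add: filterlim_iff)
qed

text \<open>Testing the subgradient inequality along \<open>\<xi>\<close> itself gives
  \<open>s * norm \<xi> ^ 2 \<le> (L + e) * s * norm \<xi>\<close> for small
  \<open>s\<close>.\<close>

lemma regular_subgradient_bound:
  assumes "has_regular_subgradient r \<xi> x" "\<forall>\<^sub>F y in nhds x. r y - r x \<le> L * norm (y - x)" "0 \<le> L"
  shows "norm \<xi> \<le> L"
proof (rule field_le_epsilon)
  fix e :: real assume e: "e > 0"
  have "\<forall>\<^sub>F y in nhds x. \<xi> \<bullet> (y - x) - e * norm (y - x) \<le> L * norm (y - x)"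
    using has_regular_subgradientD[OF assms(1) e] assms(2) by eventually_elim linarith
  from eventually_nhds_along[OF this, of \<xi>]
  have "\<forall>\<^sub>F s in at_right 0. s * (\<xi> \<bullet> \<xi>) \<le> (L + e) * (\<bar>s\<bar> * norm \<xi>) \<and> s > 0"
    using eventually_at_right_less[of 0]
    by eventually_elim (auto simp: algebra_simps)
  then obtain s :: real where "s * (\<xi> \<bullet> \<xi>) \<le> (L + e) * (\<bar>s\<bar> * norm \<xi>)" "s > 0"
    using eventually_happens[of _ "at_right (0::real)"] by force
  then have "(s * norm \<xi>) * norm \<xi> \<le> (s * norm \<xi>) * (L + e)"
    by (simp add: power2_norm_eq_inner[symmetric] power2_eq_square algebra_simps)
  then show "norm \<xi> \<le> L + e"
    using \<open>s > 0\<close> assms(3) e by (cases "\<xi> = 0") auto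
qed

text \<open>Fermat's rule: minimality bounds the increase of \<open>r\<close> from below by the
  decrease of \<open>q\<close>, which is linear up to an error
  \<open>e * norm (y - x)\<close>.\<close>

lemma regular_subgradient_of_local_min:
  fixes q :: "'a::real_inner \<Rightarrow> real"
  assumes "(q has_derivative (\<lambda>d. a \<bullet> d)) (at x)" "\<forall>\<^sub>F y in nhds x. r x + q x \<le> r y + q y"
  shows "has_regular_subgradient r (- a) x"
  unfolding has_regular_subgradient_def
proof (intro allI impI)
  fix e :: real assume "e > 0"
  with assms(1) have "\<forall>\<^sub>F y in nhds x. norm (q y - q x - a \<bullet> (y - x)) \<le> e * norm (y - x)"
    unfolding has_derivative_at_alt eventually_nhds_metric by (auto simp: dist_norm)
  with assms(2) show "\<forall>\<^sub>F y in nhds x. r x + - a \<bullet> (y - x) - e * norm (y - x) \<le> r y"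
    by eventually_elim (auto simp: abs_le_iff)
qed

section \<open>An approximate mean value inequality\<close>

text \<open>Turns information about slopes of \<open>r\<close> into information about its
  subgradients. The subgradient is found at a nearby minimizer of a perturbed function, because
  \<open>r\<close> may have no regular subgradient at \<open>x0\<close>.\<close>

lemma approximate_mean_value:
  fixes r :: "'a::euclidean_space \<Rightarrow> real"
  assumes "open S" "x0 \<in> S" "L-lipschitz_on S r" and h: "norm h = 1" and e: "e > 0"
    and slope: "\<exists>\<^sub>F s in at_right 0. r (x0 + s *\<^sub>R h) \<le> r x0 + s * (c + e)"
  obtains x \<xi> where "x \<in> S" "has_regular_subgradient r \<xi> x" "\<xi> \<bullet> h \<le> c + 4 * e"
proof -
  \<comment> \<open>\<open>L'\<close> bounds the decrease of \<open>r\<close> minus its expected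
    linear part \<open>c * T x\<close> per unit of distance from \<open>x0\<close>. The constants
    \<open>A\<close> and \<open>R\<close> are tuned to it: \<open>A\<close> excludes minimizers on
    the flat face, \<open>R\<close> those on the sphere.\<close>
  define L' where "L' = L + \<bar>c\<bar>"
  have L: "L \<ge> 0" using assms(3) by (rule lipschitz_on_nonneg)
  then have L': "L' \<ge> 0" by (simp add: L'_def)
  define A where "A = 2 * e + L'\<^sup>2 / e"
  define R where "R = 2 + (L' + 1) / e"
  have A: "A \<ge> 2 * e" using e by (simp add: A_def)
  have R: "R \<ge> 2" using e L' by (simp add: R_def)
  obtain \<rho>0 where \<rho>0: "\<rho>0 > 0" "cball x0 \<rho>0 \<subseteq> S"
    using assms(1,2) open_contains_cball by blast
  \<comment> \<open>Steps \<open>s\<close> below \<open>\<rho>1\<close> keep the half ball of radius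
    \<open>R * s\<close> inside \<open>S\<close>.\<close>
  define \<rho>1 where "\<rho>1 = \<rho>0 / R"
  have \<rho>1: "\<rho>1 > 0" using \<rho>0 R by (simp add: \<rho>1_def)
  have "\<forall>\<^sub>F s in at_right (0::real). 0 < s \<and> s < \<rho>1"
    using \<rho>1 by (auto simp: eventually_at_right intro!: exI[of _ \<rho>1])
  with slope have "\<exists>\<^sub>F s in at_right 0. r (x0 + s *\<^sub>R h) \<le> r x0 + s * (c + e) \<and> (0 < s \<and> s < \<rho>1)"
    by (rule frequently_eventually_frequently)
  then obtain s where s: "r (x0 + s *\<^sub>R h) \<le> r x0 + s * (c + e)" "0 < s" "s < \<rho>1"
    using frequently_ex by blast
  have "R * s < R * \<rho>1" using s R by (intro mult_strict_left_mono) auto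
  also have "\<dots> = \<rho>0" using R by (simp add: \<rho>1_def)
  finally have Rs: "R * s < \<rho>0" .
  define T where "T x = (x - x0) \<bullet> h" for x
  have T_le: "\<bar>T x\<bar> \<le> norm (x - x0)" for x
    using Cauchy_Schwarz_ineq2[of "x - x0" h] h by (simp add: T_def)
  txt \<open>
    A minimizer of \<open>r + q\<close> over the half ball \<open>T x \<ge> 0\<close> lies in its interior: at \<open>x0 + s *\<^sub>R h\<close>
    the value is smaller than on the flat face, where the last term costs \<open>2 * e * s\<close>, and on the sphere.
    The derivative of \<open>q\<close> along \<open>h\<close> is at least \<open>- c - 4 * e\<close> as soon as \<open>T x \<ge> 0\<close>.
  \<close>
  define q where "q x = - c * T x + (A / s) * ((norm (x - x0))\<^sup>2 - (T x)\<^sup>2) + (2 * e / s) * (T x - s)\<^sup>2" for x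
  define D where "D = cball x0 (R * s) \<inter> {x. T x \<ge> 0}"
  have DS: "D \<subseteq> S" using \<rho>0 Rs by (auto simp: D_def)
  have contr: "continuous_on S r" using assms(3) by (rule lipschitz_on_continuous_on)
  have contT: "continuous_on UNIV T" unfolding T_def by (intro continuous_intros)
  have contq: "continuous_on UNIV q" unfolding q_def T_def by (intro continuous_intros)
  have "compact D"
    unfolding D_def using contT
    by (intro compact_Int_closed compact_cball closed_Collect_le) (auto intro!: continuous_intros)
  moreover have sh: "x0 + s *\<^sub>R h \<in> D"
    using h R s by (auto simp: D_def T_def dist_norm power2_norm_eq_inner[symmetric])
  moreover have "continuous_on D (\<lambda>x. r x + q x)"
    using contr contq DS by (intro continuous_on_add) (auto elim: continuous_on_subset)
  ultimately obtain m where m: "m \<in> D" "\<And>x. x \<in> D \<Longrightarrow> r m + q m \<le> r x + q x"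
    using continuous_attains_inf[of D "\<lambda>x. r x + q x"] by blast
  have Tsh: "T (x0 + s *\<^sub>R h) = s"
    using h by (simp add: T_def power2_norm_eq_inner[symmetric])
  have "r m + q m \<le> r (x0 + s *\<^sub>R h) + q (x0 + s *\<^sub>R h)"
    using sh by (rule m(2))
  also have "q (x0 + s *\<^sub>R h) = - c * s"
    using h s by (simp add: q_def Tsh)
  finally have up: "r m + q m \<le> r x0 + e * s"
    using s(1) by (simp add: algebra_simps)
  have mS: "m \<in> S" using m DS by auto
  have low: "r m - c * T m \<ge> r x0 - L' * norm (m - x0)"
  proof -
    have "\<bar>r m - r x0\<bar> \<le> L * norm (m - x0)"
      using lipschitz_onD[OF assms(3) mS assms(2)] by (simp add: dist_norm)
    moreover have "c * T m \<le> \<bar>c\<bar> * norm (m - x0)"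
      using T_le[of m] by (metis abs_ge_self abs_ge_zero abs_mult mult_left_mono order_trans)
    ultimately show ?thesis by (simp add: L'_def algebra_simps abs_le_iff)
  qed
  define n where "n = norm (m - x0)"
  have low': "r m + q m \<ge> r x0 - L' * n + (A / s) * (n\<^sup>2 - (T m)\<^sup>2) + (2 * e / s) * (T m - s)\<^sup>2"
    using low by (simp add: q_def n_def)
  \<comment> \<open>On the flat face the comparison with \<open>x0 + s *\<^sub>R h\<close> forces
    \<open>e * s\<^sup>2 + A * n\<^sup>2 \<le> L' * n * s\<close>. After multiplication by
    \<open>e\<close> this contradicts Young's inequality for \<open>e * s\<close> and
    \<open>L' * n\<close>.\<close>
  have T_pos: "T m > 0"
  proof (rule ccontr)
    assume "\<not> T m > 0"
    with m(1) have T0: "T m = 0" by (simp add: D_def)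
    have "r x0 - L' * n + (A / s) * n\<^sup>2 + 2 * e * s \<le> r x0 + e * s"
      using low' up s T0 by (simp add: power2_eq_square)
    then have "e * s + (A / s) * n\<^sup>2 \<le> L' * n" by simp
    then have "s * (e * s + (A / s) * n\<^sup>2) \<le> s * (L' * n)"
      using s by (intro mult_left_mono) auto
    then have "e * s\<^sup>2 + A * n\<^sup>2 \<le> L' * n * s"
      using s by (simp add: algebra_simps power2_eq_square)
    then have "e * (e * s\<^sup>2 + A * n\<^sup>2) \<le> e * (L' * n * s)"
      using e by (intro mult_left_mono) auto
    moreover have "e * A = 2 * e\<^sup>2 + L'\<^sup>2"
      using e by (simp add: A_def power2_eq_square algebra_simps)
    moreover have "e * (e * s\<^sup>2 + A * n\<^sup>2) = (e * s)\<^sup>2 + (e * A) * n\<^sup>2"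
      by (simp add: algebra_simps power2_eq_square)
    ultimately have "(e * s)\<^sup>2 + 2 * (e * n)\<^sup>2 + (L' * n)\<^sup>2 \<le> (e * s) * (L' * n)"
      by (simp add: algebra_simps power2_eq_square)
    moreover have "2 * ((e * s) * (L' * n)) \<le> (e * s)\<^sup>2 + (L' * n)\<^sup>2"
      using sum_squares_bound[of "e * s" "L' * n"] by (simp add: mult.assoc)
    moreover have "(e * s)\<^sup>2 > 0" "(e * n)\<^sup>2 \<ge> 0" "(L' * n)\<^sup>2 \<ge> 0" using e s by auto
    ultimately show False by linarith
  qed
  \<comment> \<open>Since \<open>A \<ge> 2 * e\<close>, the two quadratic terms dominate
    \<open>2 * e / s\<close> times the squared distance of \<open>m\<close> from
    \<open>x0 + s *\<^sub>R h\<close>. On the sphere that distance is at least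
    \<open>(R - 1) * s\<close>, and \<open>e * (R - 1) = e + L' + 1\<close> makes the penalty too
    large.\<close>
  have interior: "n < R * s"
  proof (rule ccontr)
    assume "\<not> n < R * s"
    with m(1) have n: "n = R * s" by (simp add: D_def n_def dist_norm norm_minus_commute)
    have "(T m)\<^sup>2 \<le> n\<^sup>2" using T_le[of m] by (simp add: n_def abs_le_square_iff[symmetric])
    then have "(2 * e / s) * (n\<^sup>2 - (T m)\<^sup>2) \<le> (A / s) * (n\<^sup>2 - (T m)\<^sup>2)"
      using A s e by (intro mult_right_mono divide_right_mono) auto
    with low' up have "(2 * e / s) * (n\<^sup>2 - (T m)\<^sup>2) + (2 * e / s) * (T m - s)\<^sup>2 \<le> e * s + L' * n"
      by linarith
    also have "(2 * e / s) * (n\<^sup>2 - (T m)\<^sup>2) + (2 * e / s) * (T m - s)\<^sup>2 = (2 * e / s) * (n\<^sup>2 - 2 * s * T m + s\<^sup>2)"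
      unfolding distrib_left[symmetric]
      by (rule arg_cong[of _ _ "\<lambda>x. (2 * e / s) * x"]) (simp add: algebra_simps power2_eq_square)
    finally have "(2 * e / s) * (n\<^sup>2 - 2 * s * T m + s\<^sup>2) \<le> e * s + L' * n" .
    moreover have "n\<^sup>2 - 2 * s * n + s\<^sup>2 \<le> n\<^sup>2 - 2 * s * T m + s\<^sup>2"
      using T_le[of m] s by (simp add: n_def)
    then have "(2 * e / s) * (n\<^sup>2 - 2 * s * n + s\<^sup>2) \<le> (2 * e / s) * (n\<^sup>2 - 2 * s * T m + s\<^sup>2)"
      using e s by (intro mult_left_mono) auto
    ultimately have "(2 * e / s) * (n\<^sup>2 - 2 * s * n + s\<^sup>2) \<le> e * s + L' * n" by linarith
    then have "s * (2 * e * (R - 1)\<^sup>2) \<le> s * (e + L' * R)"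
      using s by (simp add: n algebra_simps power2_eq_square)
    then have 1: "2 * e * (R - 1)\<^sup>2 \<le> e + L' * R" using s by simp
    have "e * R = e * 2 + (L' + 1)" using e unfolding R_def distrib_left by (intro arg_cong2[of _ _ _ _ "(+)"]) auto
    then have eR: "e * (R - 1) = e + L' + 1" by (simp add: algebra_simps)
    have "2 * e * (R - 1)\<^sup>2 = 2 * (e * (R - 1)) * (R - 1)" by (simp add: power2_eq_square)
    also have "\<dots> = (e + L' + 1) * (2 * (R - 1))" unfolding eR by (simp add: algebra_simps)
    also have "\<dots> \<ge> (e + L' + 1) * R"
      using R L' e by (intro mult_left_mono) auto
    finally have "e * R + L' * R + R \<le> e + L' * R" using 1 by (simp add: algebra_simps)
    moreover have "e * R \<ge> e * 1" using R e by (intro mult_left_mono) auto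
    ultimately show False using R by simp
  qed
  have "open {x. T x > 0}"
    using contT by (intro open_Collect_less) (auto intro!: continuous_intros)
  then have "\<forall>\<^sub>F x in nhds m. x \<in> {x. T x > 0}"
    using T_pos by (intro eventually_nhds_in_open) auto
  moreover have "\<forall>\<^sub>F x in nhds m. x \<in> ball x0 (R * s)"
    using interior by (intro eventually_nhds_in_open) (auto simp: n_def dist_norm norm_minus_commute)
  ultimately have locmin: "\<forall>\<^sub>F x in nhds m. r m + q m \<le> r x + q x"
    by eventually_elim (rule m(2), auto simp: D_def)
  define a where "a = - c *\<^sub>R h + (A / s) *\<^sub>R (2 *\<^sub>R (m - x0) - (2 * T m) *\<^sub>R h) + ((2 * e / s) * (2 * (T m - s))) *\<^sub>R h"
  have "((\<lambda>x. - c * ((x - x0) \<bullet> h) + k * ((x - x0) \<bullet> (x - x0) - ((x - x0) \<bullet> h)\<^sup>2) + l * ((x - x0) \<bullet> h - s)\<^sup>2)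
      has_derivative (\<lambda>d. (- c *\<^sub>R h + k *\<^sub>R (2 *\<^sub>R (m - x0) - (2 * T m) *\<^sub>R h) + (l * (2 * (T m - s))) *\<^sub>R h) \<bullet> d)) (at m)" for k l
    by (auto intro!: derivative_eq_intros simp: T_def fun_eq_iff inner_simps inner_commute algebra_simps)
  then have "(q has_derivative (\<lambda>d. a \<bullet> d)) (at m)"
    unfolding q_def a_def T_def power2_norm_eq_inner .
  then have sub: "has_regular_subgradient r (- a) m"
    using locmin by (rule regular_subgradient_of_local_min)
  have hh: "h \<bullet> h = 1" using h by (simp add: power2_norm_eq_inner[symmetric])
  \<comment> \<open>The middle term of \<open>a\<close> is orthogonal to \<open>h\<close>, so only
    the slope \<open>c\<close> and the last quadratic term contribute.\<close>
  have "(m - x0) \<bullet> h = T m" by (simp add: T_def)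
  then have "- a \<bullet> h = c - ((2 * e / s) * (2 * (T m - s)))"
    by (simp add: a_def inner_add_left inner_diff_left hh)
  also have "\<dots> = c - (4 * e / s) * (T m - s)" by simp
  also have "\<dots> = c + 4 * e - (4 * e / s) * T m"
    using s unfolding right_diff_distrib by simp
  also have "\<dots> \<le> c + 4 * e" using e s T_pos by simp
  finally show ?thesis using sub mS by (intro that)
qed

section \<open>Directional limiting subgradients\<close>

text \<open>The radii and the constant are parameters, so that all results apply to
  \<open>- \<psi>\<close> and \<open>- r\<close> on the same cone.\<close>

locale dir_Lipschitz_function =
  fixes \<psi> :: "'a::euclidean_space \<Rightarrow> ereal" and r :: "'a \<Rightarrow> real" and x u :: 'a and \<tau> \<eta> L :: real
  assumes radii: "\<tau> > 0" "\<eta> > 0"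
    and real_valued: "\<And>a. a \<in> insert x (cone_nbhd x u \<tau> \<eta>) \<Longrightarrow> \<psi> a = ereal (r a)"
    and lipschitz: "L-lipschitz_on (insert x (cone_nbhd x u \<tau> \<eta>)) r"
begin

lemma lipschitz_const_nonneg: "0 \<le> L"
  using lipschitz by (rule lipschitz_on_nonneg)

lemma lipschitz_cone: "L-lipschitz_on (cone_nbhd x u \<tau> \<eta>) r"
  using lipschitz by (rule lipschitz_on_subset) auto

lemma regular_subdiff_cone:
  assumes "a \<in> cone_nbhd x u \<tau> \<eta>"
  shows "\<xi> \<in> regular_subdiff \<psi> a \<longleftrightarrow> has_regular_subgradient r \<xi> a"
proof (rule regular_subdiff_iff)
  have "\<forall>\<^sub>F y in nhds a. y \<in> cone_nbhd x u \<tau> \<eta>"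
    using assms by (intro eventually_nhds_in_open open_cone_nbhd)
  then show "\<forall>\<^sub>F y in nhds a. \<psi> y = ereal (r y)"
    by eventually_elim (simp add: real_valued)
qed

lemma regular_subgradient_cone_bound:
  assumes "a \<in> cone_nbhd x u \<tau> \<eta>" "has_regular_subgradient r \<xi> a"
  shows "norm \<xi> \<le> L"
proof (rule regular_subgradient_bound[OF assms(2) _ lipschitz_const_nonneg])
  have "\<forall>\<^sub>F y in nhds a. y \<in> cone_nbhd x u \<tau> \<eta>"
    using assms by (intro eventually_nhds_in_open open_cone_nbhd)
  then show "\<forall>\<^sub>F y in nhds a. r y - r a \<le> L * norm (y - a)"
  proof eventually_elim
    case (elim y)
    from lipschitz_onD[OF lipschitz_cone elim assms(1)] show ?case
      by (simp add: dist_norm)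
  qed
qed

text \<open>The convergence of function values demanded in \<open>dir_limiting_subdiff\<close> is
  automatic here: the Lipschitz estimate includes the base point.\<close>

lemma tendsto_along_directions:
  assumes t: "\<And>k. 0 < t k" "t \<longlonglongrightarrow> 0" and us: "us \<longlonglongrightarrow> u"
  shows "\<forall>\<^sub>F k in sequentially. x + t k *\<^sub>R us k \<in> cone_nbhd x u \<tau> \<eta>"
    and "(\<lambda>k. \<psi> (x + t k *\<^sub>R us k)) \<longlonglongrightarrow> \<psi> x"
proof -
  have "\<forall>\<^sub>F k in sequentially. t k < \<tau>" using t radii by (intro order_tendstoD) auto
  moreover have "\<forall>\<^sub>F k in sequentially. dist (us k) u < \<eta>" using us radii by (intro tendstoD) auto
  ultimately show ev: "\<forall>\<^sub>F k in sequentially. x + t k *\<^sub>R us k \<in> cone_nbhd x u \<tau> \<eta>"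
  proof eventually_elim
    case (elim k)
    have "dist (x + t k *\<^sub>R u) (x + t k *\<^sub>R us k) = t k * dist (us k) u"
      using t(1)[of k] by (simp add: dist_norm norm_minus_commute flip: scaleR_diff_right)
    with elim t(1)[of k] show ?case by (intro cone_nbhdI[of "t k"]) auto
  qed
  have "(\<lambda>k. r (x + t k *\<^sub>R us k)) \<longlonglongrightarrow> r x"
  proof (rule Lim_transform_eventually[OF _ eventually_mono[OF ev]])
    \<comment> \<open>Terms outside the cone are replaced by \<open>r x\<close>, so that the
      Lipschitz bound holds for every index.\<close>
    show "(\<lambda>k. if x + t k *\<^sub>R us k \<in> cone_nbhd x u \<tau> \<eta> then r (x + t k *\<^sub>R us k) else r x) \<longlonglongrightarrow> r x"
    proof (rule metric_tendsto_imp_tendsto)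
      have "(\<lambda>k. L * norm (t k *\<^sub>R us k)) \<longlonglongrightarrow> L * norm (0 *\<^sub>R u)"
        by (intro tendsto_intros t us)
      then show "(\<lambda>k. L * norm (t k *\<^sub>R us k)) \<longlonglongrightarrow> 0" by simp
      show "\<forall>\<^sub>F k in sequentially. dist (if x + t k *\<^sub>R us k \<in> cone_nbhd x u \<tau> \<eta> then r (x + t k *\<^sub>R us k) else r x) (r x)
          \<le> dist (L * norm (t k *\<^sub>R us k)) 0"
        using lipschitz_onD[OF lipschitz, of "x + t _ *\<^sub>R us _" x] lipschitz_const_nonneg
        by (intro always_eventually) (auto simp: dist_norm)
    qed
  qed auto
  then have "(\<lambda>k. ereal (r (x + t k *\<^sub>R us k))) \<longlonglongrightarrow> \<psi> x"
    by (simp add: real_valued)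
  then show "(\<lambda>k. \<psi> (x + t k *\<^sub>R us k)) \<longlonglongrightarrow> \<psi> x"
    by (rule Lim_transform_eventually) (use ev in \<open>auto simp: real_valued elim: eventually_mono\<close>)
qed

text \<open>Replaces sequences by an epsilon condition, which suits compactness and diagonal
  arguments. Conversely, \<open>e = 1 / (k + 1)\<close> yields points whose step lengths and
  difference quotients \<open>(a k - x) / t k\<close> form the required sequences.\<close>

lemma dir_limiting_subdiff_iff:
  "\<xi> \<in> dir_limiting_subdiff \<psi> x u \<longleftrightarrow>
     (\<forall>e>0. \<exists>a \<xi>'. a \<in> cone_nbhd x u e e \<and> a \<in> cone_nbhd x u \<tau> \<eta> \<and> dist \<xi>' \<xi> < e \<and> has_regular_subgradient r \<xi>' a)"
    (is "?l \<longleftrightarrow> ?r")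
proof
  assume ?l
  then obtain t :: "nat \<Rightarrow> real" and us \<xi>s where t: "\<And>k. 0 < t k" "t \<longlonglongrightarrow> 0" and us: "us \<longlonglongrightarrow> u"
    and \<xi>s: "\<xi>s \<longlonglongrightarrow> \<xi>" "\<And>k. \<xi>s k \<in> regular_subdiff \<psi> (x + t k *\<^sub>R us k)"
    by (auto simp: dir_limiting_subdiff_def)
  show ?r
  proof (intro allI impI)
    fix e :: real assume e: "e > 0"
    have "\<forall>\<^sub>F k in sequentially. t k < e" using t e by (intro order_tendstoD) auto
    moreover have "\<forall>\<^sub>F k in sequentially. dist (us k) u < e" using us e by (intro tendstoD) auto
    moreover have "\<forall>\<^sub>F k in sequentially. dist (\<xi>s k) \<xi> < e" using \<xi>s e by (intro tendstoD) auto
    ultimately have "\<forall>\<^sub>F k in sequentially. x + t k *\<^sub>R us k \<in> cone_nbhd x u e e \<and>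
        x + t k *\<^sub>R us k \<in> cone_nbhd x u \<tau> \<eta> \<and> dist (\<xi>s k) \<xi> < e"
      using tendsto_along_directions(1)[OF t us]
    proof eventually_elim
      case (elim k)
      have "dist (x + t k *\<^sub>R u) (x + t k *\<^sub>R us k) = t k * dist (us k) u"
        using t(1)[of k] by (simp add: dist_norm norm_minus_commute flip: scaleR_diff_right)
      with elim t(1)[of k] show ?case by (auto intro: cone_nbhdI[of "t k"])
    qed
    then obtain k where "x + t k *\<^sub>R us k \<in> cone_nbhd x u e e"
        "x + t k *\<^sub>R us k \<in> cone_nbhd x u \<tau> \<eta>" "dist (\<xi>s k) \<xi> < e"
      using eventually_happens'[OF sequentially_bot] by blast
    with \<xi>s(2)[of k] regular_subdiff_cone
    show "\<exists>a \<xi>'. a \<in> cone_nbhd x u e e \<and> a \<in> cone_nbhd x u \<tau> \<eta> \<and> dist \<xi>' \<xi> < e \<and> has_regular_subgradient r \<xi>' a"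
      by blast
  qed
next
  assume ?r
  then have "\<forall>k. \<exists>a \<xi>'. a \<in> cone_nbhd x u (inverse (real (Suc k))) (inverse (real (Suc k))) \<and>
      a \<in> cone_nbhd x u \<tau> \<eta> \<and> dist \<xi>' \<xi> < inverse (real (Suc k)) \<and> has_regular_subgradient r \<xi>' a"
    by simp
  then obtain a \<xi>s where a: "\<And>k. a k \<in> cone_nbhd x u (inverse (real (Suc k))) (inverse (real (Suc k)))"
      "\<And>k. a k \<in> cone_nbhd x u \<tau> \<eta>" and \<xi>s: "\<And>k. dist (\<xi>s k) \<xi> < inverse (real (Suc k))"
      "\<And>k. has_regular_subgradient r (\<xi>s k) (a k)"
    by metis
  have "\<forall>k. \<exists>t. 0 < t \<and> t < inverse (real (Suc k)) \<and> dist (x + t *\<^sub>R u) (a k) < t * inverse (real (Suc k))"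
    using a(1) by (meson cone_nbhdE)
  then obtain t where t: "\<And>k. 0 < t k" "\<And>k. t k < inverse (real (Suc k))"
      "\<And>k. dist (x + t k *\<^sub>R u) (a k) < t k * inverse (real (Suc k))"
    by metis
  define us where "us k = (1 / t k) *\<^sub>R (a k - x)" for k
  have inv0: "(\<lambda>k. inverse (real (Suc k))) \<longlonglongrightarrow> 0" by (rule LIMSEQ_inverse_real_of_nat)
  have t0: "t \<longlonglongrightarrow> 0"
    by (rule tendsto_sandwich[OF _ _ tendsto_const inv0]) (use t in \<open>auto intro!: always_eventually less_imp_le\<close>)
  have us: "us \<longlonglongrightarrow> u"
    using cone_nbhd_direction[OF t(1,3)]
    by (intro metric_tendsto_imp_tendsto[OF inv0] always_eventually)
       (auto simp: us_def dist_norm intro: less_imp_le)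
  have eq: "x + t k *\<^sub>R us k = a k" for k
    using t(1)[of k] by (simp add: us_def)
  have \<xi>lim: "\<xi>s \<longlonglongrightarrow> \<xi>"
    using \<xi>s(1) by (intro metric_tendsto_imp_tendsto[OF inv0] always_eventually) (auto intro: less_imp_le)
  have "\<xi>s k \<in> regular_subdiff \<psi> (x + t k *\<^sub>R us k)" for k
    using \<xi>s(2)[of k] a(2)[of k] by (simp add: eq regular_subdiff_cone)
  with tendsto_along_directions(2)[OF t(1) t0 us] t(1) t0 us \<xi>lim show ?l
    unfolding dir_limiting_subdiff_def by blast
qed

text \<open>Boundedness comes from the Lipschitz constant. Closedness is a diagonal argument: an
  approximation of a nearby limiting subgradient within \<open>e / 2\<close> is one of the limit
  within \<open>e\<close>.\<close>

lemma compact_dir_limiting_subdiff: "compact (dir_limiting_subdiff \<psi> x u)"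
proof -
  have "norm \<xi> \<le> L" if "\<xi> \<in> dir_limiting_subdiff \<psi> x u" for \<xi>
  proof (rule field_le_epsilon)
    fix e :: real assume "e > 0"
    with that obtain a \<xi>' where "a \<in> cone_nbhd x u \<tau> \<eta>" "dist \<xi>' \<xi> < e" "has_regular_subgradient r \<xi>' a"
      unfolding dir_limiting_subdiff_iff by blast
    with regular_subgradient_cone_bound[of a \<xi>'] norm_triangle_sub[of \<xi> \<xi>'] show "norm \<xi> \<le> L + e"
      by (simp add: dist_norm norm_minus_commute)
  qed
  then have "bounded (dir_limiting_subdiff \<psi> x u)" by (auto simp: bounded_iff)
  moreover have "closed (dir_limiting_subdiff \<psi> x u)"
  proof (rule closure_subset_eq[THEN iffD1], rule subsetI)
    fix \<xi> assume cl: "\<xi> \<in> closure (dir_limiting_subdiff \<psi> x u)"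
    show "\<xi> \<in> dir_limiting_subdiff \<psi> x u"
      unfolding dir_limiting_subdiff_iff
    proof (intro allI impI)
      fix e :: real assume e: "e > 0"
      with cl obtain \<zeta> where \<zeta>: "\<zeta> \<in> dir_limiting_subdiff \<psi> x u" "dist \<zeta> \<xi> < e / 2"
        by (auto simp: closure_approachable dest!: spec[of _ "e / 2"])
      from \<zeta>(1) e obtain a \<xi>' where a: "a \<in> cone_nbhd x u (e / 2) (e / 2)" "a \<in> cone_nbhd x u \<tau> \<eta>"
          "dist \<xi>' \<zeta> < e / 2" "has_regular_subgradient r \<xi>' a"
        unfolding dir_limiting_subdiff_iff by (meson half_gt_zero)
      have "dist \<xi>' \<xi> < e" using a(3) \<zeta>(2) dist_triangle[of \<xi>' \<xi> \<zeta>] by linarith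
      moreover have "a \<in> cone_nbhd x u e e"
        using a(1) e cone_nbhd_mono[of "e / 2" e "e / 2" e x u] by auto
      ultimately show "\<exists>a \<xi>'. a \<in> cone_nbhd x u e e \<and> a \<in> cone_nbhd x u \<tau> \<eta> \<and> dist \<xi>' \<xi> < e \<and> has_regular_subgradient r \<xi>' a"
        using a by blast
    qed
  qed
  ultimately show ?thesis by (simp add: compact_eq_bounded_closed)
qed

text \<open>The mean value inequality yields a suitable regular subgradient in every small cone.
  These are bounded by \<open>L\<close>, so a subsequence converges, and the bound on the component
  along \<open>h\<close> survives the limit.\<close>

lemma limiting_subgradient_below_slope:
  assumes h: "norm h = 1" and e: "e > 0"
    and slope: "\<And>\<delta>. \<delta> > 0 \<Longrightarrow> \<exists>a \<in> cone_nbhd x u \<delta> \<delta> \<inter> cone_nbhd x u \<tau> \<eta>.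
       \<exists>\<^sub>F s in at_right 0. r (a + s *\<^sub>R h) \<le> r a + s * (c + e)"
  obtains \<xi> where "\<xi> \<in> dir_limiting_subdiff \<psi> x u" "\<xi> \<bullet> h \<le> c + 4 * e"
proof -
  have "\<exists>a \<xi>. a \<in> cone_nbhd x u \<delta> \<delta> \<and> a \<in> cone_nbhd x u \<tau> \<eta> \<and> has_regular_subgradient r \<xi> a \<and> \<xi> \<bullet> h \<le> c + 4 * e"
    if \<delta>: "\<delta> > 0" for \<delta>
  proof -
    let ?S = "cone_nbhd x u \<delta> \<delta> \<inter> cone_nbhd x u \<tau> \<eta>"
    obtain a where a: "a \<in> ?S" "\<exists>\<^sub>F s in at_right 0. r (a + s *\<^sub>R h) \<le> r a + s * (c + e)"
      using slope[OF \<delta>] by blast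
    have "L-lipschitz_on ?S r" using lipschitz_cone by (rule lipschitz_on_subset) auto
    then obtain a' \<xi> where "a' \<in> ?S" "has_regular_subgradient r \<xi> a'" "\<xi> \<bullet> h \<le> c + 4 * e"
      using approximate_mean_value[OF open_Int[OF open_cone_nbhd open_cone_nbhd] a(1) _ h e a(2)] by metis
    then show ?thesis by blast
  qed
  then have "\<forall>k. \<exists>a \<xi>. a \<in> cone_nbhd x u (inverse (real (Suc k))) (inverse (real (Suc k))) \<and>
      a \<in> cone_nbhd x u \<tau> \<eta> \<and> has_regular_subgradient r \<xi> a \<and> \<xi> \<bullet> h \<le> c + 4 * e"
    by simp
  then obtain a \<xi>s where a: "\<And>k. a k \<in> cone_nbhd x u (inverse (real (Suc k))) (inverse (real (Suc k)))"
      "\<And>k. a k \<in> cone_nbhd x u \<tau> \<eta>" and \<xi>s: "\<And>k. has_regular_subgradient r (\<xi>s k) (a k)"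
      "\<And>k. \<xi>s k \<bullet> h \<le> c + 4 * e"
    by metis
  have "\<xi>s k \<in> cball 0 L" for k
    using regular_subgradient_cone_bound[OF a(2) \<xi>s(1)] by simp
  then obtain \<xi> \<sigma> where \<sigma>: "strict_mono \<sigma>" "(\<xi>s \<circ> \<sigma>) \<longlonglongrightarrow> \<xi>"
    using compact_cball[of "0::'a" L] unfolding compact_def by metis
  have "\<xi> \<in> dir_limiting_subdiff \<psi> x u"
    unfolding dir_limiting_subdiff_iff
  proof (intro allI impI)
    fix \<delta> :: real assume \<delta>: "\<delta> > 0"
    have "\<forall>\<^sub>F k in sequentially. dist ((\<xi>s \<circ> \<sigma>) k) \<xi> < \<delta>" using \<sigma>(2) \<delta> by (rule tendstoD)
    moreover have "(\<lambda>k. inverse (real (Suc (\<sigma> k)))) \<longlonglongrightarrow> 0"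
      using LIMSEQ_subseq_LIMSEQ[OF LIMSEQ_inverse_real_of_nat \<sigma>(1)] by (simp add: o_def)
    then have "\<forall>\<^sub>F k in sequentially. inverse (real (Suc (\<sigma> k))) < \<delta>"
      using \<delta> by (rule order_tendstoD)
    ultimately have "\<forall>\<^sub>F k in sequentially. dist (\<xi>s (\<sigma> k)) \<xi> < \<delta> \<and> inverse (real (Suc (\<sigma> k))) < \<delta>"
      by eventually_elim simp
    then obtain k where k: "dist (\<xi>s (\<sigma> k)) \<xi> < \<delta>" "inverse (real (Suc (\<sigma> k))) < \<delta>"
      using eventually_happens'[OF sequentially_bot] by blast
    then have "a (\<sigma> k) \<in> cone_nbhd x u \<delta> \<delta>"
      using a(1)[of "\<sigma> k"] cone_nbhd_mono[of "inverse (real (Suc (\<sigma> k)))" \<delta> "inverse (real (Suc (\<sigma> k)))" \<delta> x u] by auto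
    then show "\<exists>a \<xi>'. a \<in> cone_nbhd x u \<delta> \<delta> \<and> a \<in> cone_nbhd x u \<tau> \<eta> \<and> dist \<xi>' \<xi> < \<delta> \<and> has_regular_subgradient r \<xi>' a"
      using a(2) \<xi>s(1) k(1) by blast
  qed
  moreover have "\<xi> \<bullet> h \<le> c + 4 * e"
    by (rule LIMSEQ_le_const2[OF tendsto_inner[OF \<sigma>(2) tendsto_const]]) (use \<xi>s(2) in auto)
  ultimately show ?thesis by (rule that)
qed

lemma cone_nbhd_meets:
  assumes "\<delta> > 0"
  shows "cone_nbhd x u \<delta> \<delta> \<inter> cone_nbhd x u \<tau> \<eta> \<noteq> {}"
proof -
  define t where "t = min \<delta> \<tau> / 2"
  have "x + t *\<^sub>R u \<in> cone_nbhd x u \<delta> \<delta>" "x + t *\<^sub>R u \<in> cone_nbhd x u \<tau> \<eta>"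
    using assms radii by (auto intro!: cone_nbhdI[of t] simp: t_def)
  then show ?thesis by blast
qed

text \<open>All slopes along a unit vector are at most \<open>L\<close>, so the previous existence
  result applies with \<open>c = L\<close> and \<open>e = 1\<close>.\<close>

lemma dir_limiting_subdiff_nonempty: "dir_limiting_subdiff \<psi> x u \<noteq> {}"
proof -
  obtain h :: 'a where h: "norm h = 1" using nonempty_Basis norm_Basis by blast
  have "\<exists>a \<in> cone_nbhd x u \<delta> \<delta> \<inter> cone_nbhd x u \<tau> \<eta>.
       \<exists>\<^sub>F s in at_right 0. r (a + s *\<^sub>R h) \<le> r a + s * (L + 1)" if \<delta>: "\<delta> > 0" for \<delta>
  proof -
    obtain a where a: "a \<in> cone_nbhd x u \<delta> \<delta> \<inter> cone_nbhd x u \<tau> \<eta>" using cone_nbhd_meets[OF \<delta>] by blast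
    have "\<forall>\<^sub>F y in nhds a. y \<in> cone_nbhd x u \<tau> \<eta>"
      using a by (intro eventually_nhds_in_open open_cone_nbhd) auto
    from eventually_nhds_along[OF this, of h]
    have "\<forall>\<^sub>F s in at_right 0. r (a + s *\<^sub>R h) \<le> r a + s * (L + 1)"
      using eventually_at_right_less[of 0]
    proof eventually_elim
      case (elim s)
      have "dist (r (a + s *\<^sub>R h)) (r a) \<le> L * dist (a + s *\<^sub>R h) a"
        using lipschitz_cone elim(1) a by (intro lipschitz_onD) auto
      also have "\<dots> = L * s" using elim(2) h by (simp add: dist_norm)
      finally show ?case using elim(2) by (simp add: dist_norm algebra_simps abs_le_iff)
    qed
    then have "\<exists>\<^sub>F s in at_right 0. r (a + s *\<^sub>R h) \<le> r a + s * (L + 1)"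
      by (intro eventually_frequently) auto
    with a show ?thesis by blast
  qed
  then show ?thesis
    using limiting_subgradient_below_slope[OF h zero_less_one] by blast
qed

end

lemma (in dir_Lipschitz_function) uminus: "dir_Lipschitz_function (\<lambda>a. - \<psi> a) (\<lambda>a. - r a) x u \<tau> \<eta> L"
  using radii lipschitz by unfold_locales (auto simp: real_valued intro: lipschitz_on_minus)

section \<open>From the limiting subdifferential of the negative function to the Clarke
  subdifferential\<close>

text \<open>A regular subgradient of \<open>- r\<close> bounds \<open>r\<close> from above to first
  order, hence bounds its slopes along the separating direction \<open>h\<close>. The resulting
  limiting subgradient of \<open>\<psi>\<close> lies on the wrong side of the hyperplane.\<close>

lemma (in dir_Lipschitz_function) uminus_limiting_subdiff_in_Clarke:
  assumes \<xi>: "\<xi> \<in> dir_limiting_subdiff (\<lambda>a. - \<psi> a) x u"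
  shows "- \<xi> \<in> dir_Clarke_subdiff \<psi> x u"
proof (rule ccontr)
  interpret neg: dir_Lipschitz_function "\<lambda>a. - \<psi> a" "\<lambda>a. - r a" x u \<tau> \<eta> L by (rule uminus)
  let ?K = "convex hull (dir_limiting_subdiff \<psi> x u)"
  assume "- \<xi> \<notin> dir_Clarke_subdiff \<psi> x u"
  then have "- \<xi> \<notin> ?K" by (simp add: dir_Clarke_subdiff_def)
  moreover have "closed ?K"
    by (intro compact_imp_closed compact_convex_hull compact_dir_limiting_subdiff)
  ultimately obtain a b where ab: "a \<bullet> (- \<xi>) < b" "\<forall>\<zeta>\<in>?K. b < a \<bullet> \<zeta>"
    using separating_hyperplane_closed_point[of ?K "- \<xi>"] convex_convex_hull by blast
  \<comment> \<open>A zero normal \<open>a\<close> would require \<open>0 < b\<close> at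
    \<open>- \<xi>\<close> and \<open>b < 0\<close> at \<open>\<zeta>0\<close>.\<close>
  obtain \<zeta>0 where "\<zeta>0 \<in> ?K" using dir_limiting_subdiff_nonempty hull_subset by fastforce
  with ab have "a \<noteq> 0" by force
  define h where "h = (1 / norm a) *\<^sub>R a"
  have h: "norm h = 1" using \<open>a \<noteq> 0\<close> by (simp add: h_def)
  \<comment> \<open>The gap is cut into six parts. Approximating \<open>\<xi>\<close> costs one, and
    \<open>limiting_subgradient_below_slope\<close> costs four, so five of the six are used.\<close>
  define e where "e = (b / norm a - h \<bullet> (- \<xi>)) / 6"
  have "a \<bullet> (- \<xi>) / norm a < b / norm a"
    using ab(1) \<open>a \<noteq> 0\<close> by (intro divide_strict_right_mono) auto
  then have e: "e > 0" by (simp add: e_def h_def)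
  have gap: "- (\<xi> \<bullet> h) + 6 * e < \<zeta> \<bullet> h" if "\<zeta> \<in> ?K" for \<zeta>
  proof -
    have "b / norm a < a \<bullet> \<zeta> / norm a"
      using ab(2) that \<open>a \<noteq> 0\<close> by (intro divide_strict_right_mono) auto
    moreover have "\<zeta> \<bullet> h = a \<bullet> \<zeta> / norm a" by (simp add: h_def inner_commute)
    moreover have "6 * e = b / norm a + \<xi> \<bullet> h" by (simp add: e_def inner_commute)
    ultimately show ?thesis by linarith
  qed
  have "\<exists>y \<in> cone_nbhd x u \<delta> \<delta> \<inter> cone_nbhd x u \<tau> \<eta>.
       \<exists>\<^sub>F s in at_right 0. r (y + s *\<^sub>R h) \<le> r y + s * ((- (\<xi> \<bullet> h) + e) + e)" if \<delta>: "\<delta> > 0" for \<delta>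
  proof -
    have "min \<delta> e > 0" using \<delta> e by simp
    then obtain y \<xi>' where y: "y \<in> cone_nbhd x u (min \<delta> e) (min \<delta> e)" "y \<in> cone_nbhd x u \<tau> \<eta>"
        "dist \<xi>' \<xi> < min \<delta> e" "has_regular_subgradient (\<lambda>a. - r a) \<xi>' y"
      using \<xi>[unfolded neg.dir_limiting_subdiff_iff] by blast
    have y': "y \<in> cone_nbhd x u \<delta> \<delta> \<inter> cone_nbhd x u \<tau> \<eta>"
      using y(1,2) cone_nbhd_mono[of "min \<delta> e" \<delta> "min \<delta> e" \<delta> x u] by auto
    have "(\<xi> - \<xi>') \<bullet> h \<le> norm (\<xi> - \<xi>') * norm h" by (rule norm_cauchy_schwarz)
    also have "\<dots> \<le> e" using y(3) h by (simp add: dist_norm norm_minus_commute)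
    finally have \<xi>': "- (\<xi>' \<bullet> h) \<le> - (\<xi> \<bullet> h) + e" by (simp add: inner_simps)
    from eventually_nhds_along[OF has_regular_subgradientD[OF y(4) e], of h]
    have "\<forall>\<^sub>F s in at_right 0. r (y + s *\<^sub>R h) \<le> r y + s * ((- (\<xi> \<bullet> h) + e) + e)"
      using eventually_at_right_less[of 0]
    proof eventually_elim
      case (elim s)
      then have "r (y + s *\<^sub>R h) \<le> r y + s * (- (\<xi>' \<bullet> h) + e)"
        using h by (simp add: algebra_simps)
      also have "\<dots> \<le> r y + s * ((- (\<xi> \<bullet> h) + e) + e)"
        using \<xi>' elim by (intro add_left_mono mult_left_mono) auto
      finally show ?case .
    qed
    then have "\<exists>\<^sub>F s in at_right 0. r (y + s *\<^sub>R h) \<le> r y + s * ((- (\<xi> \<bullet> h) + e) + e)"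
      by (intro eventually_frequently) auto
    with y' show ?thesis by blast
  qed
  then obtain \<zeta> where "\<zeta> \<in> dir_limiting_subdiff \<psi> x u" "\<zeta> \<bullet> h \<le> (- (\<xi> \<bullet> h) + e) + 4 * e"
    using limiting_subgradient_below_slope[OF h e] by blast
  with gap[of \<zeta>] e show False by (simp add: hull_inc)
qed

section \<open>Penalization with smoothed positive parts\<close>

definition pos_part :: "'a::euclidean_space \<Rightarrow> 'a" where
  "pos_part x = (\<Sum>b\<in>Basis. max 0 (x \<bullet> b) *\<^sub>R b)"

lemma pos_part_inner: "b \<in> Basis \<Longrightarrow> pos_part x \<bullet> b = max 0 (x \<bullet> b)"
  by (simp add: pos_part_def inner_sum_left_Basis)

lemma norm_pos_part: "(norm (pos_part x))\<^sup>2 = (\<Sum>b\<in>Basis. (max 0 (x \<bullet> b))\<^sup>2)"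
  unfolding power2_norm_eq_inner euclidean_inner[of "pos_part x" "pos_part x"]
  by (simp add: pos_part_inner power2_eq_square)

lemma pos_part_eq_0_iff: "pos_part x = 0 \<longleftrightarrow> (\<forall>b\<in>Basis. x \<bullet> b \<le> 0)"
  unfolding euclidean_eq_iff[of "pos_part x" 0] by (auto simp: pos_part_inner max_def)

lemma norm_pos_part_le: "norm (pos_part x) \<le> (\<Sum>b\<in>Basis. max 0 (x \<bullet> b))"
  unfolding pos_part_def by (rule order_trans[OF norm_sum]) (auto intro!: sum_mono)

lemma continuous_on_pos_part: "continuous_on S pos_part"
  unfolding pos_part_def by (intro continuous_intros)

text \<open>Squaring removes the kink at 0: in every combination of signs of \<open>s\<close> and
  \<open>y\<close> the linearization error is at most \<open>(y - s)\<^sup>2\<close>.\<close>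

lemma DERIV_max_0_power2: "((\<lambda>s::real. (max 0 s)\<^sup>2) has_real_derivative 2 * max 0 s) (at s)"
proof -
  have bound: "\<bar>(max 0 y)\<^sup>2 - (max 0 s)\<^sup>2 - 2 * max 0 s * (y - s)\<bar> \<le> (y - s)\<^sup>2" for y :: real
  proof -
    consider "s \<le> 0" "y \<le> 0" | "s \<le> 0" "y > 0" | "s > 0" "y \<le> 0" | "s > 0" "y > 0" by linarith
    then show ?thesis
    proof cases
      case 2
      then have "y\<^sup>2 \<le> (y - s)\<^sup>2" by (intro power_mono) auto
      with 2 show ?thesis by simp
    next
      case 3
      have "s\<^sup>2 - 2 * (s * y) \<le> (y - s)\<^sup>2" by (simp add: power2_diff)
      moreover have "s * y \<le> 0" using 3 by (intro mult_nonneg_nonpos) auto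
      then have "\<bar>s\<^sup>2 - 2 * (s * y)\<bar> = s\<^sup>2 - 2 * (s * y)" using zero_le_power2[of s] by linarith
      moreover have "- (s\<^sup>2) - 2 * s * (y - s) = s\<^sup>2 - 2 * (s * y)"
        by (simp add: power2_eq_square algebra_simps)
      ultimately show ?thesis using 3 by simp
    next
      case 4
      have "y\<^sup>2 - s\<^sup>2 - 2 * s * (y - s) = (y - s)\<^sup>2" by (simp add: power2_eq_square algebra_simps)
      with 4 show ?thesis by simp
    qed auto
  qed
  have "((\<lambda>y. ((max 0 y)\<^sup>2 - (max 0 s)\<^sup>2) / (y - s) - 2 * max 0 s) \<longlongrightarrow> 0) (at s)"
  proof (rule Lim_null_comparison)
    show "\<forall>\<^sub>F y in at s. norm (((max 0 y)\<^sup>2 - (max 0 s)\<^sup>2) / (y - s) - 2 * max 0 s) \<le> \<bar>y - s\<bar>"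
      unfolding eventually_at_filter
    proof (intro always_eventually allI impI)
      fix y assume "y \<noteq> s"
      then have "((max 0 y)\<^sup>2 - (max 0 s)\<^sup>2) / (y - s) - 2 * max 0 s
          = ((max 0 y)\<^sup>2 - (max 0 s)\<^sup>2 - 2 * max 0 s * (y - s)) / (y - s)"
        by (simp add: diff_divide_distrib)
      then have "norm (((max 0 y)\<^sup>2 - (max 0 s)\<^sup>2) / (y - s) - 2 * max 0 s) \<le> (y - s)\<^sup>2 / \<bar>y - s\<bar>"
        using bound[of y] by (simp add: divide_right_mono)
      also have "(y - s)\<^sup>2 / \<bar>y - s\<bar> = (\<bar>y - s\<bar> * \<bar>y - s\<bar>) / \<bar>y - s\<bar>" by (simp add: power2_eq_square)
      also have "\<dots> = \<bar>y - s\<bar>" using \<open>y \<noteq> s\<close> by (intro nonzero_mult_div_cancel_right) simp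
      finally show "norm (((max 0 y)\<^sup>2 - (max 0 s)\<^sup>2) / (y - s) - 2 * max 0 s) \<le> \<bar>y - s\<bar>" .
    qed
    have "((\<lambda>y. \<bar>y - s\<bar>) \<longlongrightarrow> \<bar>s - s\<bar>) (at s)" by (intro tendsto_intros)
    then show "((\<lambda>y. \<bar>y - s\<bar>) \<longlongrightarrow> 0) (at s)" by simp
  qed
  then show ?thesis
    unfolding has_field_derivative_iff by (rule Lim_null[THEN iffD2])
qed

lemma has_derivative_norm_pos_part:
  fixes H :: "'b::real_normed_vector \<Rightarrow> 'a::euclidean_space"
  assumes "(H has_derivative H') (at y)"
  shows "((\<lambda>y. (norm (pos_part (H y)))\<^sup>2) has_derivative (\<lambda>d. 2 * (pos_part (H y) \<bullet> H' d))) (at y)"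
proof -
  have "((\<lambda>y. (max 0 (H y \<bullet> b))\<^sup>2) has_derivative (\<lambda>d. (2 * max 0 (H y \<bullet> b)) * (H' d \<bullet> b))) (at y)" for b
    using DERIV_compose_FDERIV[OF DERIV_max_0_power2 has_derivative_inner_left[OF assms]]
    by (simp add: mult_ac)
  then have "((\<lambda>y. (norm (pos_part (H y)))\<^sup>2) has_derivative
      (\<lambda>d. \<Sum>b\<in>Basis. (2 * max 0 (H y \<bullet> b)) * (H' d \<bullet> b))) (at y)"
    unfolding norm_pos_part by (intro has_derivative_sum)
  moreover have "(\<Sum>b\<in>Basis. (2 * max 0 (H y \<bullet> b)) * (H' d \<bullet> b)) = 2 * (pos_part (H y) \<bullet> H' d)" for d
    by (simp add: euclidean_inner[of "pos_part (H y)" "H' d"] pos_part_inner sum_distrib_left mult.assoc)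
  ultimately show ?thesis by simp
qed

text \<open>Expresses the adjoint through the values of \<open>T\<close> on a basis, so that
  convergence of a varying map at each fixed direction carries over to its adjoint.\<close>

lemma adjoint_eq_sum:
  fixes T :: "'a::euclidean_space \<Rightarrow> 'b::euclidean_space"
  assumes "linear T"
  shows "adjoint T \<mu> = (\<Sum>b\<in>Basis. (T b \<bullet> \<mu>) *\<^sub>R b)"
proof (rule euclidean_eqI)
  fix b :: 'a assume b: "b \<in> Basis"
  have "adjoint T \<mu> \<bullet> b = T b \<bullet> \<mu>"
    using adjoint_works[OF assms, of b \<mu>] by (simp add: inner_commute)
  with b show "adjoint T \<mu> \<bullet> b = (\<Sum>b\<in>Basis. (T b \<bullet> \<mu>) *\<^sub>R b) \<bullet> b"
    by (simp add: inner_sum_left_Basis)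
qed

text \<open>First-order conditions when the nonsmooth \<open>r\<close> enters through one scalar
  argument. Minimality gives \<open>\<alpha> * (r (fst y) - r (fst m)) \<le> p \<bullet> (y - m) +
  o(norm (y - m))\<close>. Moving the second block alone yields the first claim, moving along
  \<open>- p\<close> the second, and moving the first block alone the third. For
  \<open>\<alpha> = 0\<close> the second claim forces \<open>p = 0\<close>.\<close>

lemma local_min_Lipschitz_argument:
  fixes P :: "real \<times> ('a::euclidean_space \<times> 'b::euclidean_space) \<Rightarrow> real"
  assumes P: "(P has_derivative (\<lambda>d. p \<bullet> snd d - \<alpha> * fst d)) (at (r (fst m), m))"
    and S: "open S" "fst m \<in> S" "L-lipschitz_on S r" and "\<alpha> \<ge> 0"
    and min: "\<forall>\<^sub>F y in nhds m. P (r (fst m), m) \<le> P (r (fst y), y)"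
  shows "snd p = 0" "norm p \<le> \<alpha> * L" "\<alpha> > 0 \<Longrightarrow> has_regular_subgradient (\<lambda>x. - r x) (- (1 / \<alpha>) *\<^sub>R fst p) (fst m)"
proof -
  have L: "L \<ge> 0" using S(3) by (rule lipschitz_on_nonneg)
  have evS: "\<forall>\<^sub>F y in nhds m. fst y \<in> S"
  proof -
    have "(fst \<longlongrightarrow> fst m) (nhds m)" by (intro tendsto_fst filterlim_ident)
    then show ?thesis using S(1,2) by (rule topological_tendstoD)
  qed
  then have evL: "\<forall>\<^sub>F y in nhds m. \<bar>r (fst y) - r (fst m)\<bar> \<le> L * norm (y - m)"
  proof eventually_elim
    case (elim y)
    have "dist (r (fst y)) (r (fst m)) \<le> L * dist (fst y) (fst m)"
      using S(3) elim S(2) by (rule lipschitz_onD)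
    also have "\<dots> \<le> L * dist y m" using L dist_fst_le[of y m] by (intro mult_left_mono)
    finally show ?case by (simp add: dist_norm)
  qed
  have key: "\<forall>\<^sub>F y in nhds m. \<alpha> * (r (fst y) - r (fst m)) \<le> p \<bullet> (y - m) + e * norm (y - m)"
    if "e > 0" for e
  proof -
    \<comment> \<open>The increment of \<open>(r (fst y), y)\<close> is at most \<open>L + 1\<close>
      times that of \<open>y\<close>.\<close>
    define e' where "e' = e / (L + 1)"
    have e': "e' > 0" "e' * (L + 1) = e" using that L by (auto simp: e'_def)
    obtain \<delta> where \<delta>: "\<delta> > 0" "\<And>Y. norm (Y - (r (fst m), m)) < \<delta> \<Longrightarrow>
        norm (P Y - P (r (fst m), m) - (p \<bullet> snd (Y - (r (fst m), m)) - \<alpha> * fst (Y - (r (fst m), m)))) \<le> e' * norm (Y - (r (fst m), m))"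
      using P e'(1) unfolding has_derivative_at_alt by blast
    have "\<forall>\<^sub>F y in nhds m. norm (y - m) < \<delta> / (L + 1)"
      unfolding eventually_nhds_metric using \<delta>(1) L
      by (intro exI[of _ "\<delta> / (L + 1)"]) (auto simp: dist_norm)
    then show ?thesis using evL min
    proof eventually_elim
      case (elim y)
      define Y where "Y = (r (fst y), y)"
      have Y: "Y - (r (fst m), m) = (r (fst y) - r (fst m), y - m)" by (simp add: Y_def)
      have "norm (Y - (r (fst m), m)) \<le> \<bar>r (fst y) - r (fst m)\<bar> + norm (y - m)"
        unfolding Y using norm_Pair_le[of "r (fst y) - r (fst m)" "y - m"] by simp
      also have "\<dots> \<le> (L + 1) * norm (y - m)" using elim by (simp add: algebra_simps)
      finally have n: "norm (Y - (r (fst m), m)) \<le> (L + 1) * norm (y - m)" .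
      also have "\<dots> < \<delta>" using elim L by (simp add: field_simps)
      finally have "norm (P Y - P (r (fst m), m) - (p \<bullet> (y - m) - \<alpha> * (r (fst y) - r (fst m)))) \<le> e' * norm (Y - (r (fst m), m))"
        using \<delta>(2)[of Y] by (simp add: Y)
      also have "\<dots> \<le> e' * ((L + 1) * norm (y - m))" using n e' by (intro mult_left_mono) auto
      also have "\<dots> = e * norm (y - m)" using e'(2) by (simp add: mult.assoc[symmetric])
      finally show ?case using elim(3) by (simp add: Y_def abs_le_iff)
    qed
  qed
  have along: "\<exists>s>0. \<alpha> * (r (fst (m + s *\<^sub>R d)) - r (fst m)) \<le> s * (p \<bullet> d + e * norm d)
      \<and> \<bar>r (fst (m + s *\<^sub>R d)) - r (fst m)\<bar> \<le> s * (L * norm d)"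
    if "e > 0" for e d
  proof -
    have "\<forall>\<^sub>F s in at_right 0. \<alpha> * (r (fst (m + s *\<^sub>R d)) - r (fst m)) \<le> s * (p \<bullet> d + e * norm d)
      \<and> \<bar>r (fst (m + s *\<^sub>R d)) - r (fst m)\<bar> \<le> s * (L * norm d) \<and> s > 0"
      using eventually_nhds_along[OF key[OF that], of d] eventually_nhds_along[OF evL, of d] eventually_at_right_less[of 0]
      by eventually_elim (simp add: algebra_simps)
    then show ?thesis
      using eventually_happens'[OF trivial_limit_at_right_real] by blast
  qed
  show "norm p \<le> \<alpha> * L"
  proof (rule field_le_epsilon)
    fix e :: real assume e: "e > 0"
    obtain s where s: "s > 0" "\<alpha> * (r (fst (m + s *\<^sub>R - p)) - r (fst m)) \<le> s * (p \<bullet> - p + e * norm (- p))"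
        "\<bar>r (fst (m + s *\<^sub>R - p)) - r (fst m)\<bar> \<le> s * (L * norm (- p))"
      using along[OF e] by blast
    have "\<alpha> * (- (s * (L * norm p))) \<le> \<alpha> * (r (fst (m + s *\<^sub>R - p)) - r (fst m))"
      using s(3) \<open>\<alpha> \<ge> 0\<close> by (intro mult_left_mono) auto
    with s(2) have "s * (- (\<alpha> * L * norm p)) \<le> s * (- (p \<bullet> p) + e * norm p)"
      by (simp add: algebra_simps)
    then have "- (\<alpha> * L * norm p) \<le> - (p \<bullet> p) + e * norm p"
      using s(1) by (simp only: mult_le_cancel_left_pos)
    then have "norm p * norm p \<le> norm p * (\<alpha> * L + e)"
      by (simp add: power2_norm_eq_inner[symmetric] power2_eq_square algebra_simps)
    then show "norm p \<le> \<alpha> * L + e"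
      using e L \<open>\<alpha> \<ge> 0\<close> by (cases "p = 0") auto
  qed
  show "snd p = 0"
  proof (rule ccontr)
    assume nz: "snd p \<noteq> 0"
    \<comment> \<open>This direction leaves the argument of \<open>r\<close> unchanged.\<close>
    define d where "d = (0::'a, - snd p)"
    obtain s where "s > 0" "\<alpha> * (r (fst (m + s *\<^sub>R d)) - r (fst m)) \<le> s * (p \<bullet> d + (norm (snd p) / 2) * norm d)"
      using along[of "norm (snd p) / 2" d] nz by auto
    then have "0 \<le> s * (p \<bullet> d + (norm (snd p) / 2) * norm d)" by (simp add: d_def)
    with \<open>s > 0\<close> have "0 \<le> p \<bullet> d + (norm (snd p) / 2) * norm d" by (simp add: zero_le_mult_iff)
    also have "p \<bullet> d = - (norm (snd p) * norm (snd p))"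
      by (simp add: d_def inner_prod_def power2_norm_eq_inner[symmetric] power2_eq_square)
    also have "norm d = norm (snd p)" by (simp add: d_def norm_Pair)
    finally have "norm (snd p) * norm (snd p) \<le> 0" by simp
    with nz show False by (simp add: mult_le_0_iff)
  qed
  show "has_regular_subgradient (\<lambda>x. - r x) (- (1 / \<alpha>) *\<^sub>R fst p) (fst m)" if \<alpha>: "\<alpha> > 0"
    unfolding has_regular_subgradient_def
  proof (intro allI impI)
    fix e :: real assume e: "e > 0"
    have "((\<lambda>x. (x, snd m)) \<longlongrightarrow> (fst m, snd m)) (nhds (fst m))"
      by (intro tendsto_intros) (simp add: filterlim_ident)
    moreover have "\<forall>\<^sub>F y in nhds (fst m, snd m). \<alpha> * (r (fst y) - r (fst m)) \<le> p \<bullet> (y - m) + \<alpha> * e * norm (y - m)"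
      using key[of "\<alpha> * e"] \<alpha> e by simp
    ultimately have "\<forall>\<^sub>F x in nhds (fst m). \<alpha> * (r (fst (x, snd m)) - r (fst m)) \<le> p \<bullet> ((x, snd m) - m) + \<alpha> * e * norm ((x, snd m) - m)"
      by (rule eventually_compose_filterlim[rotated])
    then show "\<forall>\<^sub>F x in nhds (fst m). - r (fst m) + - (1 / \<alpha>) *\<^sub>R fst p \<bullet> (x - fst m) - e * norm (x - fst m) \<le> - r x"
    proof eventually_elim
      case (elim x)
      have "(x, snd m) - m = (x - fst m, 0)" by (simp add: prod_eq_iff)
      with elim have "\<alpha> * (r x - r (fst m)) \<le> fst p \<bullet> (x - fst m) + \<alpha> * e * norm (x - fst m)"
        by (simp add: inner_prod_def norm_Pair)
      then have "\<alpha> * (r x - r (fst m)) \<le> \<alpha> * ((1 / \<alpha>) *\<^sub>R fst p \<bullet> (x - fst m) + e * norm (x - fst m))"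
        using \<alpha> by (simp add: algebra_simps)
      then have "r x - r (fst m) \<le> (1 / \<alpha>) *\<^sub>R fst p \<bullet> (x - fst m) + e * norm (x - fst m)"
        using \<alpha> by (simp only: mult_le_cancel_left_pos)
      then show ?case by simp
    qed
  qed
qed

section \<open>The penalty function and its stationary points\<close>

text \<open>\<open>h\<close> stands for the pair of constraint maps \<open>g\<close> and
  \<open>G\<close>, treated together. The value constraint is kept apart because \<open>r\<close> is
  only Lipschitz.\<close>

locale penalized_program = dir_Lipschitz_function \<psi> r "fst z" "fst w" \<tau> \<eta> L
  for \<psi> :: "'a::euclidean_space \<Rightarrow> ereal" and r and z w :: "'a \<times> 'b::euclidean_space" and \<tau> \<eta> L +
  fixes F f :: "'a \<times> 'b \<Rightarrow> real" and gF gf :: "'a \<times> 'b \<Rightarrow> 'a \<times> 'b"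
    and h :: "'a \<times> 'b \<Rightarrow> 'c::euclidean_space" and h' :: "'a \<times> 'b \<Rightarrow> 'a \<times> 'b \<Rightarrow> 'c"
  assumes derivative_F: "\<And>y. (F has_derivative (\<lambda>d. gF y \<bullet> d)) (at y)"
    and derivative_f: "\<And>y. (f has_derivative (\<lambda>d. gf y \<bullet> d)) (at y)"
    and derivative_h: "\<And>y. (h has_derivative h' y) (at y)"
    and continuous_gF: "isCont gF z" and continuous_gf: "isCont gf z"
    and continuous_h': "\<And>d. isCont (\<lambda>y. h' y d) z"
begin

definition residual :: "'a \<times> 'b \<Rightarrow> real \<times> 'c" where
  "residual y = (f y - r (fst y), h y)"

text \<open>
  A positive \<open>\<sigma>\<close> makes the penalty differentiable in the residual at feasible points; with \<open>\<sigma> = 0\<close>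
  the multipliers are normalized, and positive only for violated constraints.
\<close>

definition violation :: "real \<Rightarrow> 'a \<times> 'b \<Rightarrow> real" where
  "violation \<sigma> y = sqrt (\<sigma>\<^sup>2 + (norm (pos_part (residual y)))\<^sup>2)"

text \<open>Where \<open>violation \<sigma> y\<close> is positive, this is the gradient of the
  penalty with respect to the residual.\<close>

definition multiplier :: "real \<Rightarrow> 'a \<times> 'b \<Rightarrow> real \<times> 'c" where
  "multiplier \<sigma> y = (1 / violation \<sigma> y) *\<^sub>R pos_part (residual y)"

text \<open>Only the smooth part of the Lagrangian; the contribution of \<open>- r\<close> is
  supplied by a subgradient.\<close>

definition lagrangian_gradient :: "real \<Rightarrow> real \<times> 'c \<Rightarrow> 'a \<times> 'b \<Rightarrow> 'a \<times> 'b" where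
  "lagrangian_gradient \<epsilon> \<nu> y = \<epsilon> *\<^sub>R gF y + fst \<nu> *\<^sub>R gf y + adjoint (h' y) (snd \<nu>)"

text \<open>For \<open>\<alpha> > 0\<close> the conditions say
  \<open>p + \<alpha> *\<^sub>R (\<xi>, 0) = 0\<close> with a regular subgradient
  \<open>\<xi>\<close> of \<open>- r\<close>. The norm bound is recorded because it still determines
  \<open>p\<close> when \<open>\<alpha>\<close> tends to 0. The vector \<open>q\<close> is the
  gradient of the localizing term.\<close>

definition stationary :: "real \<Rightarrow> real \<Rightarrow> 'a \<times> 'b \<Rightarrow> 'a \<times> 'b \<Rightarrow> bool" where
  "stationary \<epsilon> \<sigma> q m \<longleftrightarrow> m \<in> cone_nbhd z w \<tau> \<eta> \<and> violation \<sigma> m > 0 \<and>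
     (let \<alpha> = fst (multiplier \<sigma> m); p = lagrangian_gradient \<epsilon> (multiplier \<sigma> m) m + q in
       snd p = 0 \<and> norm p \<le> \<alpha> * L \<and>
       (\<alpha> > 0 \<longrightarrow> has_regular_subgradient (\<lambda>x. - r x) (- (1 / \<alpha>) *\<^sub>R fst p) (fst m)))"

lemma linear_h': "linear (h' y)"
  using derivative_h has_derivative_linear by blast

lemma violation_nonneg: "0 \<le> violation \<sigma> y"
  by (simp add: violation_def)

lemma violation_0: "violation 0 y = norm (pos_part (residual y))"
  by (simp add: violation_def)

lemma violation_0_le: "violation 0 y \<le> violation \<sigma> y"
  by (simp add: violation_def)

lemma violation_le: "0 \<le> \<sigma> \<Longrightarrow> violation \<sigma> y \<le> \<sigma> + violation 0 y"
  using sqrt_add_le_add_sqrt[of "\<sigma>\<^sup>2" "(norm (pos_part (residual y)))\<^sup>2"]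
  by (simp add: violation_def)

lemma norm_multiplier_le: "norm (multiplier \<sigma> y) \<le> 1"
proof (cases "violation \<sigma> y = 0")
  case False
  with violation_nonneg[of \<sigma> y] have "violation \<sigma> y > 0" by linarith
  with violation_0_le[of y \<sigma>] show ?thesis by (simp add: multiplier_def violation_0)
qed (simp add: multiplier_def)

lemma norm_multiplier_0: "violation 0 y > 0 \<Longrightarrow> norm (multiplier 0 y) = 1"
  by (simp add: multiplier_def violation_0)

lemma multiplier_inner: "b \<in> Basis \<Longrightarrow> multiplier \<sigma> y \<bullet> b = max 0 (residual y \<bullet> b) / violation \<sigma> y"
  by (simp add: multiplier_def pos_part_inner)

lemma multiplier_nonneg: "b \<in> Basis \<Longrightarrow> 0 \<le> multiplier \<sigma> y \<bullet> b"
  by (simp add: multiplier_inner violation_nonneg)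

lemma residual_pos:
  assumes "b \<in> Basis" "multiplier \<sigma> y \<bullet> b > 0"
  shows "residual y \<bullet> b > 0"
  using assms by (auto simp: multiplier_inner max_def zero_less_divide_iff split: if_splits)

lemma fst_multiplier_nonneg: "0 \<le> fst (multiplier \<sigma> y)"
  using multiplier_nonneg[of "(1, 0)" \<sigma> y] by (simp add: inner_prod_def Basis_prod_def)

lemma continuous_on_violation: "S \<subseteq> cone_nbhd z w \<tau> \<eta> \<Longrightarrow> continuous_on S (violation \<sigma>)"
proof -
  assume S: "S \<subseteq> cone_nbhd z w \<tau> \<eta>"
  have "continuous_on S f" "continuous_on S h"
    using derivative_f derivative_h
    by (auto intro!: continuous_at_imp_continuous_on has_derivative_continuous)
  moreover have "continuous_on S (\<lambda>y. r (fst y))"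
  proof (rule continuous_on_compose2[of "cone_nbhd (fst z) (fst w) \<tau> \<eta>" r])
    show "continuous_on (cone_nbhd (fst z) (fst w) \<tau> \<eta>) r"
      using lipschitz_cone by (rule lipschitz_on_continuous_on)
    show "fst ` S \<subseteq> cone_nbhd (fst z) (fst w) \<tau> \<eta>"
      using S by (auto intro: cone_nbhd_fst dest: subsetD)
  qed (intro continuous_intros)
  ultimately have "continuous_on S residual"
    unfolding residual_def by (intro continuous_intros)
  then have "continuous_on S (\<lambda>y. pos_part (residual y))"
    by (rule continuous_on_compose2[OF continuous_on_pos_part]) auto
  then show ?thesis
    unfolding violation_def by (intro continuous_intros)
qed

lemma stationary_of_local_min:
  assumes m: "m \<in> cone_nbhd z w \<tau> \<eta>" and pos: "violation \<sigma> m > 0"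
    and A: "(A has_derivative (\<lambda>d. q \<bullet> d)) (at m)"
    and min: "\<forall>\<^sub>F y in nhds m. \<epsilon> * F m + violation \<sigma> m + A m \<le> \<epsilon> * F y + violation \<sigma> y + A y"
  shows "stationary \<epsilon> \<sigma> q m"
proof -
  let ?\<nu> = "multiplier \<sigma> m"
  let ?Y = "(r (fst m), m)"
  txt \<open>Treating the value \<open>r (fst y)\<close> as an independent variable leaves a differentiable function.\<close>
  define P where "P Y = (\<epsilon> * F (snd Y) + A (snd Y)) + sqrt (\<sigma>\<^sup>2 + (norm (pos_part (f (snd Y) - fst Y, h (snd Y))))\<^sup>2)"
    for Y :: "real \<times> ('a \<times> 'b)"
  have P_eq: "P (r (fst y), y) = \<epsilon> * F y + violation \<sigma> y + A y" for y
    by (simp add: P_def violation_def residual_def)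
  define p where "p = lagrangian_gradient \<epsilon> ?\<nu> m + q"
  have snd': "(snd has_derivative snd) (at ?Y)"
    by (rule bounded_linear_imp_has_derivative[OF bounded_linear_snd])
  have dF: "((\<lambda>Y. F (snd Y)) has_derivative (\<lambda>d. gF m \<bullet> snd d)) (at ?Y)"
    using has_derivative_compose[OF snd', of F] derivative_F[of m] by simp
  have dA: "((\<lambda>Y. A (snd Y)) has_derivative (\<lambda>d. q \<bullet> snd d)) (at ?Y)"
    using has_derivative_compose[OF snd', of A] A by simp
  have df: "((\<lambda>Y. f (snd Y)) has_derivative (\<lambda>d. gf m \<bullet> snd d)) (at ?Y)"
    using has_derivative_compose[OF snd', of f] derivative_f[of m] by simp
  have dh: "((\<lambda>Y. h (snd Y)) has_derivative (\<lambda>d. h' m (snd d))) (at ?Y)"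
    using has_derivative_compose[OF snd', of h] derivative_h[of m] by simp
  have "((\<lambda>Y. (f (snd Y) - fst Y, h (snd Y))) has_derivative (\<lambda>d. (gf m \<bullet> snd d - fst d, h' m (snd d)))) (at ?Y)"
    by (intro has_derivative_Pair has_derivative_diff df dh bounded_linear_imp_has_derivative bounded_linear_fst)
  from has_derivative_norm_pos_part[OF this]
  have "((\<lambda>Y. (norm (pos_part (f (snd Y) - fst Y, h (snd Y))))\<^sup>2) has_derivative
      (\<lambda>d. 2 * (pos_part (residual m) \<bullet> (gf m \<bullet> snd d - fst d, h' m (snd d))))) (at ?Y)"
    by (simp add: residual_def)
  then have dN: "((\<lambda>Y. \<sigma>\<^sup>2 + (norm (pos_part (f (snd Y) - fst Y, h (snd Y))))\<^sup>2) has_derivative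
      (\<lambda>d. 0 + 2 * (pos_part (residual m) \<bullet> (gf m \<bullet> snd d - fst d, h' m (snd d))))) (at ?Y)"
    by (intro has_derivative_add has_derivative_const)
  \<comment> \<open>The square root is differentiated away from 0; this is where the positive
    violation enters.\<close>
  have pos': "0 < \<sigma>\<^sup>2 + (norm (pos_part (f (snd ?Y) - fst ?Y, h (snd ?Y))))\<^sup>2"
    using pos by (simp add: violation_def residual_def)
  have "(P has_derivative (\<lambda>d. (\<epsilon> * (gF m \<bullet> snd d) + q \<bullet> snd d)
      + (0 + 2 * (pos_part (residual m) \<bullet> (gf m \<bullet> snd d - fst d, h' m (snd d))))
        * (inverse (sqrt (\<sigma>\<^sup>2 + (norm (pos_part (f (snd ?Y) - fst ?Y, h (snd ?Y))))\<^sup>2)) / 2))) (at ?Y)"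
    unfolding P_def
    by (intro has_derivative_add has_derivative_mult_right dF dA has_derivative_real_sqrt[OF pos' dN])
  moreover have "sqrt (\<sigma>\<^sup>2 + (norm (pos_part (f (snd ?Y) - fst ?Y, h (snd ?Y))))\<^sup>2) = violation \<sigma> m"
    by (simp add: violation_def residual_def)
  moreover have "(\<epsilon> * (gF m \<bullet> snd d) + q \<bullet> snd d)
      + (0 + 2 * (pos_part (residual m) \<bullet> (gf m \<bullet> snd d - fst d, h' m (snd d)))) * (inverse (violation \<sigma> m) / 2)
      = p \<bullet> snd d - fst ?\<nu> * fst d" for d :: "real \<times> ('a \<times> 'b)"
  proof -
    have "p \<bullet> snd d - fst ?\<nu> * fst d
        = \<epsilon> * (gF m \<bullet> snd d) + q \<bullet> snd d + fst ?\<nu> * (gf m \<bullet> snd d - fst d) + adjoint (h' m) (snd ?\<nu>) \<bullet> snd d"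
      by (simp add: p_def lagrangian_gradient_def inner_simps algebra_simps)
    also have "adjoint (h' m) (snd ?\<nu>) \<bullet> snd d = snd ?\<nu> \<bullet> h' m (snd d)"
      using adjoint_works[OF linear_h', of "snd d" m "snd ?\<nu>"] by (simp add: inner_commute)
    also have "\<epsilon> * (gF m \<bullet> snd d) + q \<bullet> snd d + fst ?\<nu> * (gf m \<bullet> snd d - fst d) + snd ?\<nu> \<bullet> h' m (snd d)
        = \<epsilon> * (gF m \<bullet> snd d) + q \<bullet> snd d + ?\<nu> \<bullet> (gf m \<bullet> snd d - fst d, h' m (snd d))"
      by (simp add: inner_prod_def)
    also have "?\<nu> \<bullet> (gf m \<bullet> snd d - fst d, h' m (snd d))
        = (pos_part (residual m) \<bullet> (gf m \<bullet> snd d - fst d, h' m (snd d))) * inverse (violation \<sigma> m)"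
      by (simp add: multiplier_def divide_inverse)
    finally show ?thesis by simp
  qed
  ultimately have P': "(P has_derivative (\<lambda>d. p \<bullet> snd d - fst ?\<nu> * fst d)) (at ?Y)"
    by simp
  have min': "\<forall>\<^sub>F y in nhds m. P (r (fst m), m) \<le> P (r (fst y), y)"
    using min by (simp add: P_eq)
  note * = local_min_Lipschitz_argument[OF P' open_cone_nbhd cone_nbhd_fst[OF m] lipschitz_cone fst_multiplier_nonneg min']
  show ?thesis
    unfolding stationary_def Let_def p_def[symmetric] using m pos * by auto
qed

text \<open>A smooth variational principle with localizing term \<open>norm (x - y) ^ 2 / t\<close>.
  At \<open>y\<close> the penalty is at most \<open>2 * e * t\<close> above its values on the ball,
  so a minimizer \<open>m\<close> of the perturbed function satisfies
  \<open>norm (m - y) ^ 2 \<le> 2 * e * t ^ 2\<close>. It is therefore interior and no worse than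
  \<open>y\<close>, whence its violation is positive.\<close>

lemma approximate_stationary_point:
  assumes sub: "cball y (t * \<rho>) \<subseteq> cone_nbhd z w \<tau> \<eta>" and t: "t > 0" and \<rho>: "\<rho> > 0" and e: "0 \<le> e" "2 * e < \<rho>\<^sup>2"
    and up: "\<epsilon> * F y + violation \<sigma> y \<le> c + e * t"
    and low: "\<And>y'. y' \<in> cball y (t * \<rho>) \<Longrightarrow> c - e * t \<le> \<epsilon> * F y' + violation \<sigma> y'"
    and pos: "\<And>m. m \<in> cball y (t * \<rho>) \<Longrightarrow> \<epsilon> * F m + violation \<sigma> m \<le> \<epsilon> * F y + violation \<sigma> y \<Longrightarrow> violation \<sigma> m > 0"
  obtains m where "norm (m - y) \<le> t * sqrt (2 * e)" "stationary \<epsilon> \<sigma> ((2 / t) *\<^sub>R (m - y)) m"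
proof -
  define \<Phi> where "\<Phi> x = \<epsilon> * F x + violation \<sigma> x + (1 / t) * ((x - y) \<bullet> (x - y))" for x
  have "continuous_on (cball y (t * \<rho>)) F"
    using derivative_F by (auto intro!: continuous_at_imp_continuous_on has_derivative_continuous)
  then have "continuous_on (cball y (t * \<rho>)) \<Phi>"
    unfolding \<Phi>_def by (intro continuous_intros continuous_on_violation sub)
  moreover have "cball y (t * \<rho>) \<noteq> {}" using mult_pos_pos[OF t \<rho>] by (simp add: not_less)
  ultimately obtain m where m: "m \<in> cball y (t * \<rho>)" "\<And>x. x \<in> cball y (t * \<rho>) \<Longrightarrow> \<Phi> m \<le> \<Phi> x"
    using continuous_attains_inf[OF compact_cball, of y "t * \<rho>" \<Phi>] by blast
  have "\<Phi> m \<le> \<Phi> y" using t \<rho> by (intro m(2)) auto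
  then have le: "\<epsilon> * F m + violation \<sigma> m + (1 / t) * (norm (m - y))\<^sup>2 \<le> \<epsilon> * F y + violation \<sigma> y"
    by (simp add: \<Phi>_def power2_norm_eq_inner)
  with up low[OF m(1)] have "(1 / t) * (norm (m - y))\<^sup>2 \<le> 2 * e * t" by linarith
  then have "t * ((1 / t) * (norm (m - y))\<^sup>2) \<le> t * (2 * e * t)"
    using t by (intro mult_left_mono) auto
  then have "(norm (m - y))\<^sup>2 \<le> t\<^sup>2 * (2 * e)"
    using t by (simp add: power2_eq_square algebra_simps)
  then have "norm (m - y) \<le> sqrt (t\<^sup>2 * (2 * e))" by (simp add: real_le_rsqrt)
  then have n: "norm (m - y) \<le> t * sqrt (2 * e)" using t by (simp add: real_sqrt_mult)
  have "sqrt (2 * e) < \<rho>" using e(2) \<rho> by (simp add: real_less_lsqrt)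
  then have "t * sqrt (2 * e) < t * \<rho>" using t by (intro mult_strict_left_mono) auto
  with n have "m \<in> ball y (t * \<rho>)" by (simp add: dist_norm norm_minus_commute)
  then have "\<forall>\<^sub>F x in nhds m. x \<in> ball y (t * \<rho>)" by (intro eventually_nhds_in_open) auto
  then have locmin: "\<forall>\<^sub>F x in nhds m. \<Phi> m \<le> \<Phi> x"
    by eventually_elim (rule m(2), auto)
  have "violation \<sigma> m > 0"
    using le t by (intro pos m(1)) (smt (verit) divide_nonneg_pos mult_nonneg_nonneg zero_le_power2)
  moreover have "((\<lambda>x. (1 / t) * ((x - y) \<bullet> (x - y))) has_derivative (\<lambda>d. ((2 / t) *\<^sub>R (m - y)) \<bullet> d)) (at m)"
    using t by (auto intro!: derivative_eq_intros simp: fun_eq_iff inner_commute)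
  ultimately have "stationary \<epsilon> \<sigma> ((2 / t) *\<^sub>R (m - y)) m"
    using sub m(1) locmin unfolding \<Phi>_def by (intro stationary_of_local_min) auto
  with n show ?thesis by (rule that)
qed

end

section \<open>Limits of approximately stationary points\<close>

text \<open>A derivative also governs quotients along varying directions, because the remainder is
  small relative to \<open>t k * norm (ws k)\<close> and \<open>ws\<close> is bounded.\<close>

lemma tendsto_difference_quotient:
  fixes H :: "'a::real_normed_vector \<Rightarrow> 'b::real_normed_vector"
  assumes H: "(H has_derivative H') (at z)" and t: "\<And>k. 0 < t k" "t \<longlonglongrightarrow> 0" and ws: "ws \<longlonglongrightarrow> w"
  shows "(\<lambda>k. (1 / t k) *\<^sub>R (H (z + t k *\<^sub>R ws k) - H z)) \<longlonglongrightarrow> H' w"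
proof -
  have lin: "bounded_linear H'" using H by (rule has_derivative_bounded_linear)
  have "(\<lambda>k. (1 / t k) *\<^sub>R (H (z + t k *\<^sub>R ws k) - H z) - H' (ws k)) \<longlonglongrightarrow> 0"
  proof (rule tendstoI)
    fix e :: real assume e: "e > 0"
    define e' where "e' = e / (norm w + 1)"
    have nw: "norm w + 1 > 0" by (simp add: add_nonneg_pos)
    have e': "e' > 0" using e nw by (simp add: e'_def)
    obtain \<delta> where \<delta>: "\<delta> > 0" "\<And>y. norm (y - z) < \<delta> \<Longrightarrow> norm (H y - H z - H' (y - z)) \<le> e' * norm (y - z)"
      using H e' unfolding has_derivative_at_alt by blast
    have "(\<lambda>k. norm (t k *\<^sub>R ws k)) \<longlonglongrightarrow> norm (0 *\<^sub>R w)" by (intro tendsto_intros t ws)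
    then have "\<forall>\<^sub>F k in sequentially. norm (t k *\<^sub>R ws k) < \<delta>" using \<delta>(1) by (intro order_tendstoD) auto
    moreover have "\<forall>\<^sub>F k in sequentially. norm (ws k) < norm w + 1"
      using tendsto_norm[OF ws] by (intro order_tendstoD) auto
    ultimately show "\<forall>\<^sub>F k in sequentially. dist ((1 / t k) *\<^sub>R (H (z + t k *\<^sub>R ws k) - H z) - H' (ws k)) 0 < e"
    proof eventually_elim
      case (elim k)
      have "H' (t k *\<^sub>R ws k) = t k *\<^sub>R H' (ws k)"
        using lin by (simp add: bounded_linear.linear linear_scale)
      then have "(1 / t k) *\<^sub>R (H (z + t k *\<^sub>R ws k) - H z) - H' (ws k)
          = (1 / t k) *\<^sub>R (H (z + t k *\<^sub>R ws k) - H z - H' (t k *\<^sub>R ws k))"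
        using t(1)[of k] by (simp add: scaleR_diff_right)
      then have "norm ((1 / t k) *\<^sub>R (H (z + t k *\<^sub>R ws k) - H z) - H' (ws k))
          = (1 / t k) * norm (H (z + t k *\<^sub>R ws k) - H z - H' (t k *\<^sub>R ws k))"
        using t(1)[of k] by simp
      also have "\<dots> \<le> (1 / t k) * (e' * norm (t k *\<^sub>R ws k))"
        using \<delta>(2)[of "z + t k *\<^sub>R ws k"] elim t(1)[of k] by (intro mult_left_mono) auto
      also have "\<dots> = e' * norm (ws k)" using t(1)[of k] by simp
      also have "\<dots> < e' * (norm w + 1)" using elim e' by (intro mult_strict_left_mono) auto
      also have "\<dots> = e" using nw by (simp add: e'_def)
      finally show ?case by simp
    qed
  qed
  moreover have "(\<lambda>k. H' (ws k)) \<longlonglongrightarrow> H' w" using bounded_linear.tendsto[OF lin ws] .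
  ultimately show ?thesis using tendsto_add by fastforce
qed

lemma eventually_le_along_descent:
  fixes H :: "'a::real_normed_vector \<Rightarrow> real"
  assumes H: "(H has_derivative H') (at z)" and "H' w \<le> 0" and e: "e > 0"
  shows "\<forall>\<^sub>F t in at_right 0. H (z + t *\<^sub>R w) \<le> H z + e * t"
proof -
  define e' where "e' = e / (norm w + 1)"
  have nw: "norm w + 1 > 0" by (simp add: add_nonneg_pos)
  have e': "e' > 0" using e nw by (simp add: e'_def)
  have "\<forall>\<^sub>F y in nhds z. norm (H y - H z - H' (y - z)) \<le> e' * norm (y - z)"
    using H e' unfolding has_derivative_at_alt eventually_nhds_metric by (auto simp: dist_norm)
  from eventually_nhds_along[OF this, of w] eventually_at_right_less[of 0]
  show ?thesis
  proof eventually_elim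
    case (elim t)
    have "H' (t *\<^sub>R w) = t * H' w"
      using has_derivative_bounded_linear[OF H] by (simp add: bounded_linear.linear linear_scale)
    also have "\<dots> \<le> 0" using assms(2) elim(2) by (simp add: mult_nonneg_nonpos)
    finally have "H (z + t *\<^sub>R w) \<le> H z + e' * (t * norm w)" using elim by (simp add: abs_le_iff)
    also have "e' * (t * norm w) \<le> e' * (t * (norm w + 1))"
      using e' elim by (intro mult_left_mono) auto
    also have "\<dots> = e * t" using nw by (simp add: e'_def)
    finally show ?case by simp
  qed
qed

context penalized_program
begin

text \<open>The limit passage shared by both cases, with limiting objective weight
  \<open>\<epsilon>\<close>. The multipliers stay in the unit ball, so a subsequence converges. For
  \<open>\<epsilon> = 0\<close> no smoothing is allowed, which keeps their norm equal to 1.\<close>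

lemma limit_multipliers:
  assumes appr: "\<And>e. e > 0 \<Longrightarrow> \<exists>t m \<epsilon>' \<sigma> q. 0 < t \<and> t < e \<and> dist (z + t *\<^sub>R w) m < t * e \<and>
      dist \<epsilon>' \<epsilon> < e \<and> norm q < e \<and> (\<epsilon> = 0 \<longrightarrow> \<sigma> = 0) \<and> stationary \<epsilon>' \<sigma> q m"
  obtains \<nu> \<xi> t ws where "\<And>b. b \<in> Basis \<Longrightarrow> 0 \<le> \<nu> \<bullet> b"
    "\<xi> \<in> dir_limiting_subdiff (\<lambda>a. - \<psi> a) (fst z) (fst w)"
    "lagrangian_gradient \<epsilon> \<nu> z + fst \<nu> *\<^sub>R (\<xi>, 0) = 0" "\<epsilon> = 0 \<Longrightarrow> norm \<nu> = 1"
    "\<And>k. 0 < t k" "t \<longlonglongrightarrow> (0::real)" "ws \<longlonglongrightarrow> w" "\<And>k::nat. z + t k *\<^sub>R ws k \<in> cone_nbhd z w \<tau> \<eta>"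
    "\<And>k b. b \<in> Basis \<Longrightarrow> \<nu> \<bullet> b > 0 \<Longrightarrow> residual (z + t k *\<^sub>R ws k) \<bullet> b > 0"
proof -
  interpret neg: dir_Lipschitz_function "\<lambda>a. - \<psi> a" "\<lambda>a. - r a" "fst z" "fst w" \<tau> \<eta> L by (rule uminus)
  define i where "i k = inverse (real (Suc k))" for k
  have i: "i k > 0" for k by (simp add: i_def)
  have i0: "i \<longlonglongrightarrow> 0" unfolding i_def by (rule LIMSEQ_inverse_real_of_nat)
  have "\<forall>k. \<exists>t m \<epsilon>' \<sigma> q. 0 < t \<and> t < i k \<and> dist (z + t *\<^sub>R w) m < t * i k \<and>
      dist \<epsilon>' \<epsilon> < i k \<and> norm q < i k \<and> (\<epsilon> = 0 \<longrightarrow> \<sigma> = 0) \<and> stationary \<epsilon>' \<sigma> q m"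
    using appr[OF i] by blast
  then obtain t m \<epsilon>s \<sigma> q where seq: "\<And>k. 0 < t k" "\<And>k. t k < i k" "\<And>k. dist (z + t k *\<^sub>R w) (m k) < t k * i k"
      "\<And>k. dist (\<epsilon>s k) \<epsilon> < i k" "\<And>k. norm (q k) < i k" "\<And>k. \<epsilon> = 0 \<Longrightarrow> \<sigma> k = 0"
      "\<And>k. stationary (\<epsilon>s k) (\<sigma> k) (q k) (m k)"
    by metis
  define \<nu> where "\<nu> k = multiplier (\<sigma> k) (m k)" for k
  define p where "p k = lagrangian_gradient (\<epsilon>s k) (\<nu> k) (m k) + q k" for k
  have stat: "m k \<in> cone_nbhd z w \<tau> \<eta>" "violation (\<sigma> k) (m k) > 0" "snd (p k) = 0"
      "norm (p k) \<le> fst (\<nu> k) * L"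
      "fst (\<nu> k) > 0 \<Longrightarrow> has_regular_subgradient (\<lambda>x. - r x) (- (1 / fst (\<nu> k)) *\<^sub>R fst (p k)) (fst (m k))" for k
    using seq(7)[of k] unfolding stationary_def Let_def \<nu>_def[symmetric] p_def[symmetric] by auto
  define ws where "ws k = (1 / t k) *\<^sub>R (m k - z)" for k
  have m_eq: "z + t k *\<^sub>R ws k = m k" for k
    using seq(1)[of k] by (simp add: ws_def)
  have t0: "t \<longlonglongrightarrow> 0"
    by (rule tendsto_sandwich[OF _ _ tendsto_const i0]) (use seq(1,2) in \<open>auto intro!: always_eventually less_imp_le\<close>)
  have ws: "ws \<longlonglongrightarrow> w"
    using cone_nbhd_direction[OF seq(1,3)] i
    by (intro metric_tendsto_imp_tendsto[OF i0] always_eventually)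
       (auto simp: ws_def dist_norm abs_of_pos intro!: less_imp_le)
  have \<epsilon>s: "\<epsilon>s \<longlonglongrightarrow> \<epsilon>"
    using seq(4) i by (intro metric_tendsto_imp_tendsto[OF i0] always_eventually) (auto simp: abs_of_pos intro: less_imp_le)
  have q0: "q \<longlonglongrightarrow> 0"
    using seq(5) i by (intro metric_tendsto_imp_tendsto[OF i0] always_eventually) (auto simp: abs_of_pos intro: less_imp_le)
  have "\<nu> k \<in> cball 0 1" for k using norm_multiplier_le by (simp add: \<nu>_def)
  then obtain \<nu>0 s where s: "strict_mono s" "(\<nu> \<circ> s) \<longlonglongrightarrow> \<nu>0"
    using compact_cball[of "0 :: real \<times> 'c" 1] unfolding compact_def by metis
  have sub: "(\<lambda>k. X (s k)) \<longlonglongrightarrow> l" if "X \<longlonglongrightarrow> l" for X :: "nat \<Rightarrow> 'x::topological_space" and l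
    using LIMSEQ_subseq_LIMSEQ[OF that s(1)] by (simp add: o_def)
  have \<nu>s: "(\<lambda>k. \<nu> (s k)) \<longlonglongrightarrow> \<nu>0" using s(2) by (simp add: o_def)
  have "(\<lambda>k. z + t k *\<^sub>R ws k) \<longlonglongrightarrow> z + 0 *\<^sub>R w" by (intro tendsto_intros t0 ws)
  then have mz: "m \<longlonglongrightarrow> z" by (simp add: m_eq)
  define p0 where "p0 = lagrangian_gradient \<epsilon> \<nu>0 z"
  have p_lim: "(\<lambda>k. p (s k)) \<longlonglongrightarrow> p0"
  proof -
    have "(\<lambda>k. gF (m (s k))) \<longlonglongrightarrow> gF z" "(\<lambda>k. gf (m (s k))) \<longlonglongrightarrow> gf z"
      using isCont_tendsto_compose[OF continuous_gF sub[OF mz]] isCont_tendsto_compose[OF continuous_gf sub[OF mz]] by auto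
    moreover have "(\<lambda>k. h' (m (s k)) d) \<longlonglongrightarrow> h' z d" for d
      using isCont_tendsto_compose[OF continuous_h' sub[OF mz]] .
    then have "(\<lambda>k. adjoint (h' (m (s k))) (snd (\<nu> (s k)))) \<longlonglongrightarrow> adjoint (h' z) (snd \<nu>0)"
      unfolding adjoint_eq_sum[OF linear_h'] by (intro tendsto_intros \<nu>s)
    ultimately have "(\<lambda>k. p (s k)) \<longlonglongrightarrow> lagrangian_gradient \<epsilon> \<nu>0 z + 0"
      unfolding p_def lagrangian_gradient_def by (intro tendsto_intros sub[OF \<epsilon>s] sub[OF q0] \<nu>s)
    then show ?thesis by (simp add: p0_def)
  qed
  have nonneg: "0 \<le> \<nu>0 \<bullet> b" if "b \<in> Basis" for b
    using multiplier_nonneg[OF that]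
    by (intro LIMSEQ_le_const[OF tendsto_inner[OF \<nu>s tendsto_const]]) (auto simp: \<nu>_def)
  have fst0: "0 \<le> fst \<nu>0" using nonneg[of "(1, 0)"] by (simp add: inner_prod_def Basis_prod_def)
  have snd0: "snd p0 = 0"
    using tendsto_snd[OF p_lim] by (simp add: stat(3) LIMSEQ_const_iff)
  have norm_p0: "norm p0 \<le> fst \<nu>0 * L"
    by (rule LIMSEQ_le[OF tendsto_norm[OF p_lim] tendsto_mult[OF tendsto_fst[OF \<nu>s] tendsto_const]]) (use stat(4) in auto)
  \<comment> \<open>If the value multiplier vanishes in the limit, the norm bound gives
    \<open>p0 = 0\<close> and any limiting subgradient serves. Otherwise the regular subgradients,
    being quotients by this multiplier, converge.\<close>
  have "\<exists>\<xi> \<in> dir_limiting_subdiff (\<lambda>a. - \<psi> a) (fst z) (fst w). p0 + fst \<nu>0 *\<^sub>R (\<xi>, 0) = 0"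
  proof (cases "fst \<nu>0 = 0")
    case True
    then have "p0 = 0" using norm_p0 by simp
    with True neg.dir_limiting_subdiff_nonempty show ?thesis by (auto simp: zero_prod_def)
  next
    case False
    with fst0 have pos: "fst \<nu>0 > 0" by simp
    define \<xi> where "\<xi> = - (1 / fst \<nu>0) *\<^sub>R fst p0"
    have \<xi>_lim: "(\<lambda>k. - (1 / fst (\<nu> (s k))) *\<^sub>R fst (p (s k))) \<longlonglongrightarrow> \<xi>"
      unfolding \<xi>_def by (intro tendsto_intros \<nu>s p_lim) (use pos in auto)
    have "\<xi> \<in> dir_limiting_subdiff (\<lambda>a. - \<psi> a) (fst z) (fst w)"
      unfolding neg.dir_limiting_subdiff_iff
    proof (intro allI impI)
      fix e :: real assume e: "e > 0"
      have "\<forall>\<^sub>F k in sequentially. dist (- (1 / fst (\<nu> (s k))) *\<^sub>R fst (p (s k))) \<xi> < e" using \<xi>_lim e by (rule tendstoD)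
      moreover have "\<forall>\<^sub>F k in sequentially. fst (\<nu> (s k)) > 0"
        using tendsto_fst[OF \<nu>s] pos by (rule order_tendstoD)
      moreover have "\<forall>\<^sub>F k in sequentially. i (s k) < e" using sub[OF i0] e by (rule order_tendstoD)
      ultimately have "\<forall>\<^sub>F k in sequentially. dist (- (1 / fst (\<nu> (s k))) *\<^sub>R fst (p (s k))) \<xi> < e \<and>
          fst (\<nu> (s k)) > 0 \<and> i (s k) < e"
        by eventually_elim simp
      then obtain k where k: "dist (- (1 / fst (\<nu> (s k))) *\<^sub>R fst (p (s k))) \<xi> < e" "fst (\<nu> (s k)) > 0" "i (s k) < e"
        using eventually_happens'[OF sequentially_bot] by blast
      have "t (s k) * i (s k) < t (s k) * e" using k(3) seq(1) by (intro mult_strict_left_mono) auto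
      then have "m (s k) \<in> cone_nbhd z w e e"
        using seq(1,2)[of "s k"] k(3) less_trans[OF seq(3)] by (intro cone_nbhdI[of "t (s k)"]) auto
      then show "\<exists>a \<xi>'. a \<in> cone_nbhd (fst z) (fst w) e e \<and> a \<in> cone_nbhd (fst z) (fst w) \<tau> \<eta> \<and>
          dist \<xi>' \<xi> < e \<and> has_regular_subgradient (\<lambda>a. - r a) \<xi>' a"
        using k(1) stat(5)[OF k(2)] cone_nbhd_fst stat(1) by blast
    qed
    moreover have "p0 + fst \<nu>0 *\<^sub>R (\<xi>, 0) = 0"
      using pos snd0 by (simp add: \<xi>_def prod_eq_iff)
    ultimately show ?thesis by blast
  qed
  then obtain \<xi> where \<xi>: "\<xi> \<in> dir_limiting_subdiff (\<lambda>a. - \<psi> a) (fst z) (fst w)" "p0 + fst \<nu>0 *\<^sub>R (\<xi>, 0) = 0" by blast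
  have norm1: "norm \<nu>0 = 1" if "\<epsilon> = 0"
  proof -
    have "norm (\<nu> k) = 1" for k
      using norm_multiplier_0 stat(2)[of k] seq(6)[OF that, of k] by (simp add: \<nu>_def)
    with tendsto_norm[OF \<nu>s] show ?thesis by (simp add: LIMSEQ_const_iff)
  qed
  have "\<forall>\<^sub>F k in sequentially. \<forall>b\<in>Basis. \<nu>0 \<bullet> b > 0 \<longrightarrow> residual (m (s k)) \<bullet> b > 0"
  proof (intro eventually_ball_finite finite_Basis ballI)
    fix b :: "real \<times> 'c" assume b: "b \<in> Basis"
    show "\<forall>\<^sub>F k in sequentially. \<nu>0 \<bullet> b > 0 \<longrightarrow> residual (m (s k)) \<bullet> b > 0"
    proof (cases "\<nu>0 \<bullet> b > 0")
      case True
      have "(\<lambda>k. \<nu> (s k) \<bullet> b) \<longlonglongrightarrow> \<nu>0 \<bullet> b" by (intro tendsto_intros \<nu>s)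
      then have "\<forall>\<^sub>F k in sequentially. \<nu> (s k) \<bullet> b > 0" using True by (rule order_tendstoD)
      then show ?thesis by eventually_elim (use residual_pos[OF b] in \<open>auto simp: \<nu>_def\<close>)
    qed simp
  qed
  \<comment> \<open>A positive component of the limit is eventually positive along the sequence,
    which means a violated constraint. There are finitely many components, so one tail works for
    all.\<close>
  then obtain K where K: "\<And>k b. k \<ge> K \<Longrightarrow> b \<in> Basis \<Longrightarrow> \<nu>0 \<bullet> b > 0 \<Longrightarrow> residual (m (s k)) \<bullet> b > 0"
    by (auto simp: eventually_sequentially)
  show ?thesis
  proof (rule that[of \<nu>0 \<xi> "\<lambda>k. t (s (k + K))" "\<lambda>k. ws (s (k + K))"])
    show "(\<lambda>k. t (s (k + K))) \<longlonglongrightarrow> 0" using sub[OF t0] by (rule LIMSEQ_ignore_initial_segment)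
    show "(\<lambda>k. ws (s (k + K))) \<longlonglongrightarrow> w" using sub[OF ws] by (rule LIMSEQ_ignore_initial_segment)
  qed (use nonneg \<xi> norm1 seq(1) stat(1) K in \<open>auto simp: p0_def m_eq\<close>)
qed

text \<open>Violation along the sequence passes to the limit in the function value and, once this is
  known to be 0, in the difference quotient. Feasibility and criticality give the opposite
  inequalities.\<close>

lemma complementarity:
  assumes feas: "h z \<bullet> b \<le> 0" and crit: "h z \<bullet> b = 0 \<Longrightarrow> h' z w \<bullet> b \<le> 0"
    and t: "\<And>k. 0 < t k" "t \<longlonglongrightarrow> 0" and ws: "ws \<longlonglongrightarrow> w"
    and pos: "\<And>k. h (z + t k *\<^sub>R ws k) \<bullet> b > 0"
  shows "h z \<bullet> b = 0" "h' z w \<bullet> b = 0"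
proof -
  have "(\<lambda>k. z + t k *\<^sub>R ws k) \<longlonglongrightarrow> z + 0 *\<^sub>R w" by (intro tendsto_intros t ws)
  then have "(\<lambda>k. h (z + t k *\<^sub>R ws k)) \<longlonglongrightarrow> h z"
    using derivative_h[of z] by (intro isCont_tendsto_compose[of _ h] has_derivative_continuous) auto
  then have "(\<lambda>k. h (z + t k *\<^sub>R ws k) \<bullet> b) \<longlonglongrightarrow> h z \<bullet> b" by (intro tendsto_intros)
  then have "0 \<le> h z \<bullet> b" using pos by (intro LIMSEQ_le_const) (auto intro: less_imp_le)
  with feas show hz: "h z \<bullet> b = 0" by simp
  have "(\<lambda>k. ((1 / t k) *\<^sub>R (h (z + t k *\<^sub>R ws k) - h z)) \<bullet> b) \<longlonglongrightarrow> h' z w \<bullet> b"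
    by (intro tendsto_intros tendsto_difference_quotient[OF derivative_h t ws])
  moreover have "0 \<le> ((1 / t k) *\<^sub>R (h (z + t k *\<^sub>R ws k) - h z)) \<bullet> b" for k
    using pos[of k] t(1)[of k] by (simp add: inner_diff_left hz)
  ultimately have "0 \<le> h' z w \<bullet> b" by (intro LIMSEQ_le_const) auto
  with crit[OF hz] show "h' z w \<bullet> b = 0" by simp
qed


text \<open>Active constraints grow at most like \<open>o(t)\<close> by criticality, and inactive
  ones remain negative by continuity. The sum of the positive components bounds the norm.\<close>

lemma violation_along_direction:
  assumes feas: "\<And>b. b \<in> Basis \<Longrightarrow> h z \<bullet> b \<le> 0"
    and crit: "\<And>b. b \<in> Basis \<Longrightarrow> h z \<bullet> b = 0 \<Longrightarrow> h' z w \<bullet> b \<le> 0"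
    and crit_f: "\<And>e. e > 0 \<Longrightarrow> \<forall>\<^sub>F t in at_right 0. f (z + t *\<^sub>R w) - r (fst (z + t *\<^sub>R w)) \<le> e * t"
    and e: "e > 0"
  shows "\<forall>\<^sub>F t in at_right 0. violation 0 (z + t *\<^sub>R w) \<le> e * t"
proof -
  \<comment> \<open>The allowance \<open>e\<close> is shared equally by all components of the
    residual.\<close>
  define D where "D = real (DIM(real \<times> 'c))"
  have D: "D > 0" unfolding D_def using DIM_positive[where 'a = "real \<times> 'c"] by (simp del: DIM_prod)
  define e' where "e' = e / D"
  have e': "e' > 0" using e D by (simp add: e'_def)
  have "\<forall>\<^sub>F t in at_right 0. h (z + t *\<^sub>R w) \<bullet> b \<le> e' * t" if b: "b \<in> Basis" for b
  proof (cases "h z \<bullet> b = 0")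
    case True
    have "((\<lambda>y. h y \<bullet> b) has_derivative (\<lambda>d. h' z d \<bullet> b)) (at z)"
      by (rule has_derivative_inner_left[OF derivative_h])
    from eventually_le_along_descent[OF this crit[OF b True] e'] True show ?thesis by simp
  next
    case False
    with feas[OF b] have neg: "h z \<bullet> b < 0" by simp
    have "isCont h z" using derivative_h has_derivative_continuous by blast
    then have "((\<lambda>y. h y \<bullet> b) \<longlongrightarrow> h z \<bullet> b) (nhds z)"
      by (auto intro!: tendsto_intros simp: isCont_def tendsto_at_iff_tendsto_nhds)
    then have "\<forall>\<^sub>F y in nhds z. h y \<bullet> b < 0" using neg by (rule order_tendstoD)
    from eventually_nhds_along[OF this, of w] eventually_at_right_less[of 0] show ?thesis
    proof eventually_elim
      case (elim t)
      then have "0 \<le> e' * t" using e' by simp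
      with elim show ?case by linarith
    qed
  qed
  then have h_ev: "\<forall>\<^sub>F t in at_right 0. \<forall>b\<in>Basis. h (z + t *\<^sub>R w) \<bullet> b \<le> e' * t"
    by (intro eventually_ball_finite) auto
  show ?thesis
    using h_ev crit_f[OF e'] eventually_at_right_less[of 0]
  proof eventually_elim
    case (elim t)
    have "violation 0 (z + t *\<^sub>R w) \<le> (\<Sum>b\<in>Basis. max 0 (residual (z + t *\<^sub>R w) \<bullet> b))"
      unfolding violation_0 by (rule norm_pos_part_le)
    also have "\<dots> \<le> (\<Sum>b\<in>(Basis :: (real \<times> 'c) set). e' * t)"
    proof (rule sum_mono)
      fix b :: "real \<times> 'c" assume "b \<in> Basis"
      then have "residual (z + t *\<^sub>R w) \<bullet> b \<le> e' * t"
        using elim by (auto simp: Basis_prod_def residual_def)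
      then show "max 0 (residual (z + t *\<^sub>R w) \<bullet> b) \<le> e' * t" using e' elim by simp
    qed
    also have "\<dots> = D * (e' * t)" by (simp add: D_def del: DIM_prod)
    also have "\<dots> = e * t" using D by (simp add: e'_def)
    finally show ?case .
  qed
qed

section \<open>Stationary points near the direction in the exact and inexact penalty cases\<close>

text \<open>The centre is \<open>z + t *\<^sub>R w\<close> and the smoothing parameter is
  \<open>t\<^sup>2\<close>. Exactness bounds the penalty from below by
  \<open>\<epsilon> * F z\<close>, while criticality makes the centre optimal up to
  \<open>o(t)\<close>.\<close>

lemma stationary_sequence_exact:
  assumes "\<epsilon> > 0" "\<tau>1 > 0" "\<eta>1 > 0"
    and exact: "\<And>y. y \<in> cone_nbhd z w \<tau>1 \<eta>1 \<Longrightarrow> \<epsilon> * F z \<le> \<epsilon> * F y + violation 0 y"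
    and crit_F: "gF z \<bullet> w \<le> 0"
    and crit: "\<And>e. e > 0 \<Longrightarrow> \<forall>\<^sub>F t in at_right 0. violation 0 (z + t *\<^sub>R w) \<le> e * t"
    and e: "e > 0"
  shows "\<exists>t m \<sigma> q. 0 < t \<and> t < e \<and> dist (z + t *\<^sub>R w) m < t * e \<and> norm q < e \<and> stationary \<epsilon> \<sigma> q m"
proof -
  define \<rho> where "\<rho> = min \<eta> \<eta>1 / 2"
  have \<rho>: "\<rho> > 0" "\<rho> < \<eta>" "\<rho> < \<eta>1" using assms(3) radii by (auto simp: \<rho>_def)
  define s where "s = min \<rho> e / 4"
  have s: "s > 0" "s < \<rho>" "2 * s < e" using \<rho> e by (auto simp: s_def)
  \<comment> \<open>This choice makes the displacement of the stationary point at most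
    \<open>t * s\<close>, so the norm of the localizing gradient is at most
    \<open>2 * s\<close>.\<close>
  define e1 where "e1 = s\<^sup>2 / 2"
  have e1: "e1 > 0" "sqrt (2 * e1) = s" "2 * e1 < \<rho>\<^sup>2" using s by (auto simp: e1_def power_strict_mono)
  have "\<forall>\<^sub>F t in at_right 0. F (z + t *\<^sub>R w) \<le> F z + (e1 / (3 * \<epsilon>)) * t"
    using e1 assms(1) crit_F by (intro eventually_le_along_descent[OF derivative_F]) auto
  moreover have "\<forall>\<^sub>F t in at_right 0. violation 0 (z + t *\<^sub>R w) \<le> (e1 / 3) * t"
    using e1 by (intro crit) simp
  moreover have "\<forall>\<^sub>F t in at_right (0::real). t < min (min \<tau> \<tau>1) (min e (e1 / 3))"
    using radii assms(2) e e1
    by (intro order_tendstoD[OF tendsto_ident_at]) auto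
  ultimately have "\<forall>\<^sub>F t in at_right 0. F (z + t *\<^sub>R w) \<le> F z + (e1 / (3 * \<epsilon>)) * t \<and>
      violation 0 (z + t *\<^sub>R w) \<le> (e1 / 3) * t \<and> t < min (min \<tau> \<tau>1) (min e (e1 / 3)) \<and> 0 < t"
    using eventually_at_right_less[of 0] by eventually_elim simp
  then obtain t where t: "F (z + t *\<^sub>R w) \<le> F z + (e1 / (3 * \<epsilon>)) * t"
      "violation 0 (z + t *\<^sub>R w) \<le> (e1 / 3) * t" "t < \<tau>" "t < \<tau>1" "t < e" "t < e1 / 3" "0 < t"
    using eventually_happens'[OF trivial_limit_at_right_real] by force
  let ?y = "z + t *\<^sub>R w"
  have cb: "dist ?y y' < t * \<eta> \<and> dist ?y y' < t * \<eta>1" if "y' \<in> cball ?y (t * \<rho>)" for y'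
  proof -
    have "t * \<rho> < t * \<eta>" "t * \<rho> < t * \<eta>1" using \<rho> t(7) by (auto intro: mult_strict_left_mono)
    with that show ?thesis by auto
  qed
  have sub: "cball ?y (t * \<rho>) \<subseteq> cone_nbhd z w \<tau> \<eta>"
    using cb t by (auto intro!: cone_nbhdI[of t])
  \<comment> \<open>The budget \<open>e1 * t\<close> is split into thirds: the increase of the
    objective, the violation, and the smoothing \<open>t\<^sup>2\<close>.\<close>
  have up: "\<epsilon> * F ?y + violation (t\<^sup>2) ?y \<le> \<epsilon> * F z + e1 * t"
  proof -
    have "\<epsilon> * F ?y \<le> \<epsilon> * (F z + (e1 / (3 * \<epsilon>)) * t)" using t(1) assms(1) by (intro mult_left_mono) auto
    also have "\<dots> = \<epsilon> * F z + (e1 / 3) * t" using assms(1) by (simp add: distrib_left)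
    finally have "\<epsilon> * F ?y \<le> \<epsilon> * F z + (e1 / 3) * t" .
    moreover have "violation (t\<^sup>2) ?y \<le> t\<^sup>2 + violation 0 ?y" by (intro violation_le) simp
    moreover have "t\<^sup>2 \<le> (e1 / 3) * t" unfolding power2_eq_square using t by (intro mult_right_mono) auto
    ultimately show ?thesis using t(2) by (simp add: field_simps)
  qed
  have low: "\<epsilon> * F z - e1 * t \<le> \<epsilon> * F y' + violation (t\<^sup>2) y'" if "y' \<in> cball ?y (t * \<rho>)" for y'
  proof -
    have "y' \<in> cone_nbhd z w \<tau>1 \<eta>1" using cb[OF that] t by (intro cone_nbhdI[of t]) auto
    from exact[OF this] violation_0_le[of y' "t\<^sup>2"] mult_pos_pos[OF e1(1) t(7)] show ?thesis by linarith
  qed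
  have pos: "violation (t\<^sup>2) y > 0" for y
    unfolding violation_def using t(7) by (simp add: add_pos_nonneg)
  obtain m where m: "norm (m - ?y) \<le> t * s" "stationary \<epsilon> (t\<^sup>2) ((2 / t) *\<^sub>R (m - ?y)) m"
    using approximate_stationary_point[OF sub t(7) \<rho>(1) less_imp_le[OF e1(1)] e1(3) up low pos] e1(2) by auto
  have "dist ?y m \<le> t * s" using m(1) by (simp add: dist_norm norm_minus_commute)
  also have "\<dots> < t * e" using s t(7) by (intro mult_strict_left_mono) auto
  finally have "dist ?y m < t * e" .
  moreover have "norm ((2 / t) *\<^sub>R (m - ?y)) < e"
  proof -
    have "norm ((2 / t) *\<^sub>R (m - ?y)) = (2 / t) * norm (m - ?y)" using t(7) by simp
    also have "\<dots> \<le> (2 / t) * (t * s)" using m(1) t(7) by (intro mult_left_mono) auto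
    also have "\<dots> = 2 * s" using t(7) by simp
    finally show ?thesis using s by simp
  qed
  ultimately show ?thesis using m(2) t by blast
qed

text \<open>Here the centre is a point whose penalty value beats that of \<open>z\<close>, and no
  smoothing is used. A small weight \<open>\<epsilon>\<close> makes this point nearly optimal on a
  ball, because the violation is nonnegative and the objective varies only by a multiple of
  \<open>t\<close>.\<close>

lemma stationary_sequence_inexact:
  assumes inexact: "\<And>\<epsilon> \<tau>1 \<eta>1. \<epsilon> > 0 \<Longrightarrow> \<tau>1 > 0 \<Longrightarrow> \<eta>1 > 0 \<Longrightarrow>
      \<exists>y \<in> cone_nbhd z w \<tau>1 \<eta>1. \<epsilon> * F y + violation 0 y < \<epsilon> * F z"
    and "\<rho>0 > 0"
    and opt: "\<And>y. y \<in> cone_nbhd z w \<tau> \<eta> \<Longrightarrow> dist z y < \<rho>0 \<Longrightarrow> violation 0 y = 0 \<Longrightarrow> F z \<le> F y"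
    and e: "e > 0"
  shows "\<exists>t m \<epsilon> q. 0 < t \<and> t < e \<and> dist (z + t *\<^sub>R w) m < t * e \<and> dist \<epsilon> 0 < e \<and> norm q < e \<and> stationary \<epsilon> 0 q m"
proof -
  define s where "s = min \<eta> e / 4"
  have s: "s > 0" "4 * s \<le> \<eta>" "4 * s \<le> e" using radii e by (auto simp: s_def)
  define \<rho> where "\<rho> = \<eta> / 2"
  have \<rho>: "\<rho> > 0" "s < \<rho>" using s radii by (auto simp: \<rho>_def)
  define e1 where "e1 = s\<^sup>2 / 2"
  have e1: "e1 > 0" "sqrt (2 * e1) = s" "2 * e1 < \<rho>\<^sup>2" using s \<rho> by (auto simp: e1_def power_strict_mono)
  define K where "K = norm w + \<eta>"
  have K: "K > 0" using radii by (simp add: K_def add_nonneg_pos)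
  define C where "C = norm (gF z) + 1"
  have C: "C > 0" by (simp add: C_def add_nonneg_pos)
  obtain \<delta> where \<delta>: "\<delta> > 0" "\<And>y. norm (y - z) < \<delta> \<Longrightarrow> norm (F y - F z - gF z \<bullet> (y - z)) \<le> 1 * norm (y - z)"
    using derivative_F[of z] unfolding has_derivative_at_alt by (meson zero_less_one)
  have F_lip: "\<bar>F y - F z\<bar> \<le> C * dist z y" if "dist z y < \<delta>" for y
  proof -
    have "\<bar>gF z \<bullet> (y - z)\<bar> \<le> norm (gF z) * norm (y - z)" by (rule Cauchy_Schwarz_ineq2)
    with \<delta>(2)[of y] that show ?thesis
      by (simp add: C_def dist_norm norm_minus_commute algebra_simps abs_le_iff)
  qed
  \<comment> \<open>On the ball used below \<open>F\<close> differs from \<open>F z\<close> by at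
    most \<open>C * K * t\<close>, so its weighted change stays within
    \<open>e1 * t\<close>.\<close>
  define \<epsilon> where "\<epsilon> = min (e / 2) (e1 / (C * K))"
  have \<epsilon>: "\<epsilon> > 0" "\<epsilon> < e" "\<epsilon> * (C * K) \<le> e1"
  proof -
    show "\<epsilon> > 0" "\<epsilon> < e" using e e1 C K by (auto simp: \<epsilon>_def)
    have "\<epsilon> * (C * K) \<le> e1 / (C * K) * (C * K)" using C K by (intro mult_right_mono) (auto simp: \<epsilon>_def)
    then show "\<epsilon> * (C * K) \<le> e1" using C K by simp
  qed
  \<comment> \<open>Points of the ball lie within \<open>t * K\<close> of \<open>z\<close>; this
    bound keeps them where \<open>F_lip\<close> and the local optimality of \<open>z\<close>
    apply.\<close>
  define \<tau>1 where "\<tau>1 = min (min \<tau> e) (min \<delta> \<rho>0 / K)"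
  have "\<tau>1 > 0" using radii e \<delta>(1) assms(2) K by (simp add: \<tau>1_def)
  from inexact[OF \<epsilon>(1) this s(1)]
  obtain y where y: "y \<in> cone_nbhd z w \<tau>1 s" "\<epsilon> * F y + violation 0 y < \<epsilon> * F z" by blast
  from y(1) obtain t where t: "0 < t" "t < \<tau>1" "dist (z + t *\<^sub>R w) y < t * s" by (rule cone_nbhdE)
  have tK: "t * K < \<delta>" "t * K < \<rho>0" and t': "t < \<tau>" "t < e"
    using t(2) K by (auto simp: \<tau>1_def pos_less_divide_eq)
  have cb: "dist (z + t *\<^sub>R w) y' < t * \<eta>" if "y' \<in> cball y (t * \<rho>)" for y'
  proof -
    have "dist (z + t *\<^sub>R w) y' < t * s + t * \<rho>"
      using that t(3) dist_triangle[of "z + t *\<^sub>R w" y' y] by auto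
    also have "\<dots> = t * (s + \<rho>)" by (simp add: algebra_simps)
    also have "\<dots> \<le> t * \<eta>" using s t(1) \<rho> by (intro mult_left_mono) (auto simp: \<rho>_def)
    finally show ?thesis .
  qed
  have near: "dist z y' < t * K" if "y' \<in> cball y (t * \<rho>)" for y'
    using cone_nbhd_dist[OF t(1) cb[OF that]] by (simp add: K_def)
  have sub: "cball y (t * \<rho>) \<subseteq> cone_nbhd z w \<tau> \<eta>"
    using cb t(1) t' by (auto intro!: cone_nbhdI[of t])
  have up: "\<epsilon> * F y + violation 0 y \<le> \<epsilon> * F z + e1 * t"
    using y(2) mult_pos_pos[OF e1(1) t(1)] by linarith
  have low: "\<epsilon> * F z - e1 * t \<le> \<epsilon> * F y' + violation 0 y'" if y': "y' \<in> cball y (t * \<rho>)" for y'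
  proof -
    have "\<bar>F y' - F z\<bar> \<le> C * dist z y'" using near[OF y'] tK by (intro F_lip) auto
    also have "\<dots> \<le> C * (t * K)" using near[OF y'] C by (intro mult_left_mono) auto
    finally have "\<epsilon> * (F z - F y') \<le> \<epsilon> * (C * (t * K))"
      using \<epsilon>(1) by (intro mult_left_mono) (auto simp: abs_le_iff)
    also have "\<dots> = (\<epsilon> * (C * K)) * t" by simp
    also have "\<dots> \<le> e1 * t" using \<epsilon>(3) t(1) by (intro mult_right_mono) auto
    finally show ?thesis using violation_nonneg[of 0 y'] by (simp add: algebra_simps)
  qed
  \<comment> \<open>A point at least as good as \<open>y\<close> with zero violation would have a
    smaller objective than \<open>z\<close>, against local optimality.\<close>
  have pos: "violation 0 m > 0"
    if m: "m \<in> cball y (t * \<rho>)" "\<epsilon> * F m + violation 0 m \<le> \<epsilon> * F y + violation 0 y" for m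
  proof (rule ccontr)
    assume "\<not> violation 0 m > 0"
    then have v: "violation 0 m = 0" using violation_nonneg[of 0 m] by linarith
    with m(2) y(2) have "\<epsilon> * F m < \<epsilon> * F z" by linarith
    then have "F m < F z" using \<epsilon>(1) by simp
    moreover have "F z \<le> F m" using sub m(1) near[OF m(1)] tK v by (intro opt) auto
    ultimately show False by simp
  qed
  obtain m where m: "norm (m - y) \<le> t * s" "stationary \<epsilon> 0 ((2 / t) *\<^sub>R (m - y)) m"
    using approximate_stationary_point[OF sub t(1) \<rho>(1) less_imp_le[OF e1(1)] e1(3) up low pos] e1(2) by auto
  have "dist (z + t *\<^sub>R w) m \<le> dist (z + t *\<^sub>R w) y + norm (m - y)"
    using dist_triangle[of "z + t *\<^sub>R w" m y] by (simp add: dist_norm norm_minus_commute)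
  also have "\<dots> < t * s + t * s" using t(3) m(1) by linarith
  also have "\<dots> = t * (2 * s)" by simp
  also have "\<dots> \<le> t * e" using s t(1) by (intro mult_left_mono) auto
  finally have "dist (z + t *\<^sub>R w) m < t * e" .
  moreover have "norm ((2 / t) *\<^sub>R (m - y)) < e"
  proof -
    have "norm ((2 / t) *\<^sub>R (m - y)) = (2 / t) * norm (m - y)" using t(1) by simp
    also have "\<dots> \<le> (2 / t) * (t * s)" using m(1) t(1) by (intro mult_left_mono) auto
    also have "\<dots> = 2 * s" using t(1) by simp
    finally show ?thesis using s by simp
  qed
  moreover have "dist \<epsilon> 0 < e" using \<epsilon> by (simp add: dist_norm)
  ultimately show ?thesis using m(2) t(1) t' by blast
qed

text \<open>\<open>\<epsilon>\<close> is the weight of the objective. An exact penalty weight is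
  kept unchanged in the limit; if none exists, stationary points are available for arbitrarily small
  weights and the limit weight is 0.\<close>

lemma Fritz_John_multipliers:
  assumes feas: "\<And>b. b \<in> Basis \<Longrightarrow> h z \<bullet> b \<le> 0"
    and crit_h: "\<And>b. b \<in> Basis \<Longrightarrow> h z \<bullet> b = 0 \<Longrightarrow> h' z w \<bullet> b \<le> 0"
    and crit_f: "\<And>e. e > 0 \<Longrightarrow> \<forall>\<^sub>F t in at_right 0. f (z + t *\<^sub>R w) - r (fst (z + t *\<^sub>R w)) \<le> e * t"
    and crit_F: "gF z \<bullet> w \<le> 0"
    and "\<rho>0 > 0"
    and opt: "\<And>y. y \<in> cone_nbhd z w \<tau> \<eta> \<Longrightarrow> dist z y < \<rho>0 \<Longrightarrow> violation 0 y = 0 \<Longrightarrow> F z \<le> F y"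
  obtains \<epsilon> \<nu> \<xi> t ws where "0 \<le> \<epsilon>" "\<And>b. b \<in> Basis \<Longrightarrow> 0 \<le> \<nu> \<bullet> b"
    "\<xi> \<in> dir_limiting_subdiff (\<lambda>a. - \<psi> a) (fst z) (fst w)"
    "lagrangian_gradient \<epsilon> \<nu> z + fst \<nu> *\<^sub>R (\<xi>, 0) = 0" "\<epsilon> = 0 \<Longrightarrow> norm \<nu> = 1"
    "\<And>k. 0 < t k" "t \<longlonglongrightarrow> (0::real)" "ws \<longlonglongrightarrow> w" "\<And>k::nat. z + t k *\<^sub>R ws k \<in> cone_nbhd z w \<tau> \<eta>"
    "\<And>k b. b \<in> Basis \<Longrightarrow> \<nu> \<bullet> b > 0 \<Longrightarrow> residual (z + t k *\<^sub>R ws k) \<bullet> b > 0"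
proof (cases "\<exists>\<epsilon>>0. \<exists>\<tau>1>0. \<exists>\<eta>1>0. \<forall>y \<in> cone_nbhd z w \<tau>1 \<eta>1. \<epsilon> * F z \<le> \<epsilon> * F y + violation 0 y")
  case True
  then obtain \<epsilon> \<tau>1 \<eta>1 where pos: "\<epsilon> > 0" "\<tau>1 > 0" "\<eta>1 > 0"
    and exact: "\<And>y. y \<in> cone_nbhd z w \<tau>1 \<eta>1 \<Longrightarrow> \<epsilon> * F z \<le> \<epsilon> * F y + violation 0 y" by blast
  have "\<exists>t m \<epsilon>' \<sigma> q. 0 < t \<and> t < e \<and> dist (z + t *\<^sub>R w) m < t * e \<and>
      dist \<epsilon>' \<epsilon> < e \<and> norm q < e \<and> (\<epsilon> = 0 \<longrightarrow> \<sigma> = 0) \<and> stationary \<epsilon>' \<sigma> q m" if e: "e > 0" for e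
  proof -
    have "\<exists>t m \<sigma> q. 0 < t \<and> t < e \<and> dist (z + t *\<^sub>R w) m < t * e \<and> norm q < e \<and> stationary \<epsilon> \<sigma> q m"
      by (rule stationary_sequence_exact[OF pos exact crit_F violation_along_direction[OF feas crit_h crit_f] e])
    with pos(1) e show ?thesis by (metis dist_self less_irrefl)
  qed
  from limit_multipliers[OF this] show ?thesis using that pos(1) by (metis less_imp_le)
next
  case False
  then have inexact: "\<exists>y \<in> cone_nbhd z w \<tau>1 \<eta>1. \<epsilon> * F y + violation 0 y < \<epsilon> * F z"
    if "\<epsilon> > 0" "\<tau>1 > 0" "\<eta>1 > 0" for \<epsilon> \<tau>1 \<eta>1
    using that by (meson not_less)
  \<comment> \<open>The trivial premise \<open>0 = 0\<close> gives the statement the shape of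
    \<open>limit_multipliers\<close> at limit weight 0.\<close>
  have "\<exists>t m \<epsilon>' \<sigma> q. 0 < t \<and> t < e \<and> dist (z + t *\<^sub>R w) m < t * e \<and>
      dist \<epsilon>' 0 < e \<and> norm q < e \<and> ((0::real) = 0 \<longrightarrow> \<sigma> = 0) \<and> stationary \<epsilon>' \<sigma> q m" if e: "e > 0" for e
  proof -
    have "\<exists>t m \<epsilon> q. 0 < t \<and> t < e \<and> dist (z + t *\<^sub>R w) m < t * e \<and> dist \<epsilon> 0 < e \<and> norm q < e \<and> stationary \<epsilon> 0 q m"
      by (rule stationary_sequence_inexact[OF inexact assms(5) opt e])
    then show ?thesis by blast
  qed
  from limit_multipliers[OF this] show ?thesis using that by (metis order_refl)
qed

end

section \<open>The bilevel program\<close>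

text \<open>By Riesz representation the gradient is the adjoint of the derivative applied to 1, and
  the basis formula for the adjoint gives its continuity.\<close>

lemma cont_differentiable_gradient:
  fixes \<phi> :: "'a::euclidean_space \<Rightarrow> real"
  assumes "cont_differentiable \<phi>"
  shows "(\<phi> has_derivative (\<lambda>d. gradient \<phi> y \<bullet> d)) (at y)" "isCont (gradient \<phi>) y"
proof -
  obtain \<phi>' where \<phi>': "\<And>y. (\<phi> has_derivative blinfun_apply (\<phi>' y)) (at y)" "continuous_on UNIV \<phi>'"
    using assms by (auto simp: cont_differentiable_def)
  have lin: "linear (blinfun_apply (\<phi>' y))" for y by (simp add: bounded_linear.linear blinfun.bounded_linear_right)
  define D where "D y = adjoint (blinfun_apply (\<phi>' y)) 1" for y
  have D: "blinfun_apply (\<phi>' y) = (\<lambda>d. d \<bullet> D y)" for y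
    using adjoint_works[OF lin, of _ y 1] by (auto simp: D_def)
  have "gradient \<phi> y = D y" for y
    unfolding gradient_def gderiv_def
  proof (rule the_equality)
    show "(\<phi> has_derivative (\<lambda>d. d \<bullet> D y)) (at y)" using \<phi>'(1)[of y] by (simp add: D)
    fix E assume "(\<phi> has_derivative (\<lambda>d. d \<bullet> E)) (at y)"
    with \<phi>'(1)[of y] have "(\<lambda>d. d \<bullet> E) = (\<lambda>d. d \<bullet> D y)"
      using has_derivative_unique[of \<phi> _ y] by (metis D)
    then show "E = D y" by (metis vector_eq_ldot inner_commute)
  qed
  then have grad: "gradient \<phi> = D" by auto
  show "(\<phi> has_derivative (\<lambda>d. gradient \<phi> y \<bullet> d)) (at y)"
    using \<phi>'(1)[of y] by (simp add: D grad inner_commute)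
  have "isCont \<phi>' y" using \<phi>'(2) by (simp add: continuous_on_eq_continuous_at)
  then show "isCont (gradient \<phi>) y"
    unfolding grad D_def adjoint_eq_sum[OF lin] by (intro continuous_intros)
qed

lemma cont_differentiable_deriv_map:
  assumes "cont_differentiable \<phi>"
  shows "(\<phi> has_derivative deriv_map \<phi> y) (at y)" "isCont (\<lambda>y. deriv_map \<phi> y d) y"
proof -
  obtain \<phi>' where \<phi>': "\<And>y. (\<phi> has_derivative blinfun_apply (\<phi>' y)) (at y)" "continuous_on UNIV \<phi>'"
    using assms by (auto simp: cont_differentiable_def)
  have eq: "deriv_map \<phi> y = blinfun_apply (\<phi>' y)" for y
    using frechet_derivative_at[OF \<phi>'(1)] by simp
  show "(\<phi> has_derivative deriv_map \<phi> y) (at y)" using \<phi>'(1) by (simp add: eq)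
  have "isCont \<phi>' y" using \<phi>'(2) by (simp add: continuous_on_eq_continuous_at)
  then show "isCont (\<lambda>y. deriv_map \<phi> y d) y"
    unfolding eq by (intro continuous_intros)
qed

lemma Basis_real_vec: "(Basis :: (real ^ 'n) set) = range (\<lambda>i. axis i 1)"
  by (auto simp: Basis_vec_def)

lemma Basis_constraints:
  "(Basis :: (real \<times> (real ^ 'p) \<times> (real ^ 'q)) set) =
     insert (1, 0, 0) (range (\<lambda>i. (0, axis i 1, 0)) \<union> range (\<lambda>i. (0, 0, axis i 1)))"
  by (auto simp: Basis_prod_def Basis_real_vec image_iff zero_prod_def)

text \<open>Separates the multiplier of the combined constraint map into those of \<open>g\<close>
  and \<open>G\<close>.\<close>

lemma adjoint_Pair:
  fixes S :: "'a::euclidean_space \<Rightarrow> 'b::euclidean_space" and T :: "'a \<Rightarrow> 'c::euclidean_space"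
  assumes "linear S" "linear T"
  shows "adjoint (\<lambda>d. (S d, T d)) (a, b) = adjoint S a + adjoint T b"
proof -
  have "adjoint (\<lambda>d. (S d, T d)) = (\<lambda>(a, b). adjoint S a + adjoint T b)"
    using assms by (intro adjoint_unique) (auto simp: inner_prod_def inner_add_right adjoint_works)
  then show ?thesis by simp
qed

lemma orthogonal_vec_nonneg:
  fixes a x :: "real ^ 'n"
  assumes "0 \<le> a" "\<And>i. a $ i > 0 \<Longrightarrow> x $ i = 0"
  shows "orthogonal a x"
proof -
  have "a $ i * x $ i = 0" for i
    using assms(1) assms(2)[of i] by (cases "a $ i = 0") (auto simp: less_eq_vec_def order_less_le)
  then show ?thesis unfolding orthogonal_def inner_vec_def inner_real_def by (intro sum.neutral ballI)
qed

section \<open>The value function reformulation\<close>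

lemma value_function_le: "g (x, y) \<le> 0 \<Longrightarrow> value_function f g x \<le> ereal (f (x, y))"
  unfolding value_function_def by (intro INF_lower) simp

lemma value_function_lower_solution:
  "y \<in> lower_solutions f g x \<Longrightarrow> value_function f g x = ereal (f (x, y))"
  by (intro antisym value_function_le) (auto simp: value_function_def lower_solutions_def intro!: INF_greatest)

text \<open>\<open>a\<close> is the lower level infimum at \<open>x\<close>, so a feasible
  \<open>y\<close> whose value does not exceed it attains the infimum.\<close>

lemma feasible_of_value_function_le:
  assumes "value_function f g x = ereal a" "f (x, y) \<le> a" "g (x, y) \<le> 0" "G (x, y) \<le> 0"
  shows "(x, y) \<in> BP_feasible f g G"
  using assms value_function_le[where f = f and g = g and x = x]
  by (force simp: BP_feasible_def lower_solutions_def intro: order_trans)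

text \<open>The critical inequality for \<open>f\<close> in quantitative form: quotients of
  \<open>\<psi>\<close> eventually exceed \<open>a \<bullet> w - e / 2\<close>, while those of
  \<open>f\<close> are eventually at most \<open>a \<bullet> w + e / 2\<close>. Only the order of
  the extended reals is used, so an infinite limit is covered.\<close>

lemma eventually_dir_quotient_bound:
  fixes f :: "'a::real_inner \<times> 'b::real_inner \<Rightarrow> real" and \<psi> :: "'a \<Rightarrow> ereal"
  assumes f: "(f has_derivative (\<lambda>d. a \<bullet> d)) (at z)" and diff: "dir_differentiable \<psi> (fst z) (fst w)"
    and le: "ereal (a \<bullet> w) \<le> dir_derivative \<psi> (fst z) (fst w)"
    and \<psi>: "\<psi> (fst z) = ereal (f z)" "\<forall>\<^sub>F t in at_right 0. \<psi> (fst z + t *\<^sub>R fst w) = ereal (r (fst z + t *\<^sub>R fst w))"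
    and e: "e > 0"
  shows "\<forall>\<^sub>F t in at_right 0. f (z + t *\<^sub>R w) - r (fst (z + t *\<^sub>R w)) \<le> e * t"
proof -
  obtain l where l: "(dir_quotient \<psi> (fst z) (fst w) \<longlongrightarrow> l) (at_right 0)"
    using diff by (auto simp: dir_differentiable_def)
  then have "dir_derivative \<psi> (fst z) (fst w) = l"
    unfolding dir_derivative_def by (intro tendsto_Lim) auto
  with le have "ereal (a \<bullet> w) \<le> l" by simp
  moreover have "ereal (a \<bullet> w - e / 2) < ereal (a \<bullet> w)" using e by simp
  ultimately have "ereal (a \<bullet> w - e / 2) < l" by (rule less_le_trans[rotated])
  with l have "\<forall>\<^sub>F t in at_right 0. ereal (a \<bullet> w - e / 2) < dir_quotient \<psi> (fst z) (fst w) t"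
    by (rule order_tendstoD)
  \<comment> \<open>Subtracting the linear part leaves derivative 0, to which the descent estimate
    applies.\<close>
  moreover have "((\<lambda>y. f y - a \<bullet> y) has_derivative (\<lambda>d. a \<bullet> d - a \<bullet> d)) (at z)"
    by (intro has_derivative_diff f has_derivative_inner_right has_derivative_ident)
  then have "\<forall>\<^sub>F t in at_right 0. f (z + t *\<^sub>R w) - a \<bullet> (z + t *\<^sub>R w) \<le> f z - a \<bullet> z + (e / 2) * t"
    using e by (intro eventually_le_along_descent) auto
  ultimately show ?thesis
    using \<psi>(2) eventually_at_right_less[of 0]
  proof eventually_elim
    case (elim t)
    have "a \<bullet> w - e / 2 < (r (fst z + t *\<^sub>R fst w) - f z) / t"
      using elim \<psi>(1) by (simp add: dir_quotient_def)
    then have "(a \<bullet> w - e / 2) * t < r (fst z + t *\<^sub>R fst w) - f z"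
      using elim(4) by (simp add: pos_less_divide_eq)
    with elim(2) show ?case by (simp add: inner_add_right algebra_simps)
  qed
qed

theorem theorem5p2:
  fixes F f :: "(real ^ 'n) \<times> (real ^ 'm) \<Rightarrow> real"
    and G :: "(real ^ 'n) \<times> (real ^ 'm) \<Rightarrow> real ^ 'q"
    and g :: "(real ^ 'n) \<times> (real ^ 'm) \<Rightarrow> real ^ 'p"
    and xb u :: "real ^ 'n" and yb v :: "real ^ 'm"
  assumes "cont_differentiable F" "cont_differentiable f"
    and "cont_differentiable G" "cont_differentiable g"
    and "BP_local_minimizer F f g G (xb, yb)"
    and "dir_Lipschitz (value_function f g) xb u"
    and "dir_differentiable (value_function f g) xb u"
    and "(u, v) \<in> critical_cone F f g G (xb, yb)"
    and "dir_quasi_normality f g G (xb, yb) (u, v)"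
  shows
    "(\<exists>(lV :: real) (lg :: real ^ 'p) (lG :: real ^ 'q).
        0 \<in> {gradient F (xb, yb) + lV *\<^sub>R gradient f (xb, yb) + lV *\<^sub>R (\<zeta>, 0)
              + adjoint (deriv_map g (xb, yb)) lg + adjoint (deriv_map G (xb, yb)) lG
             | \<zeta>. \<zeta> \<in> dir_limiting_subdiff (\<lambda>x. - value_function f g x) xb u} \<and>
        0 \<le> lV \<and>
        0 \<le> lg \<and> orthogonal lg (g (xb, yb)) \<and> orthogonal lg (deriv_map g (xb, yb) (u, v)) \<and>
        0 \<le> lG \<and> orthogonal lG (G (xb, yb)) \<and> orthogonal lG (deriv_map G (xb, yb) (u, v))) \<and>
     (\<exists>(lV :: real) (lg :: real ^ 'p) (lG :: real ^ 'q).
        0 \<in> {gradient F (xb, yb) + lV *\<^sub>R gradient f (xb, yb) - lV *\<^sub>R (\<zeta>, 0)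
              + adjoint (deriv_map g (xb, yb)) lg + adjoint (deriv_map G (xb, yb)) lG
             | \<zeta>. \<zeta> \<in> dir_Clarke_subdiff (value_function f g) xb u} \<and>
        0 \<le> lV \<and>
        0 \<le> lg \<and> orthogonal lg (g (xb, yb)) \<and> orthogonal lg (deriv_map g (xb, yb) (u, v)) \<and>
        0 \<le> lG \<and> orthogonal lG (G (xb, yb)) \<and> orthogonal lG (deriv_map G (xb, yb) (u, v)))"
proof -
  let ?V = "value_function f g" and ?z = "(xb, yb)" and ?w = "(u, v)"
  let ?Dg = "deriv_map g ?z" and ?DG = "deriv_map G ?z"
  obtain r L \<tau> \<eta> where rad: "\<tau> > 0" "\<eta> > 0"
    and rv: "\<And>a. a \<in> insert xb (cone_nbhd xb u \<tau> \<eta>) \<Longrightarrow> ?V a = ereal (r a)"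
    and lip: "L-lipschitz_on (insert xb (cone_nbhd xb u \<tau> \<eta>)) r"
    by (rule dir_LipschitzE[OF assms(6)]) (rule that)
  interpret dir_Lipschitz_function ?V r xb u \<tau> \<eta> L
    using rad rv lip by unfold_locales
  note dg = cont_differentiable_deriv_map[OF assms(4)] and dG = cont_differentiable_deriv_map[OF assms(3)]
  interpret pen: penalized_program ?V r ?z ?w \<tau> \<eta> L F f "gradient F" "gradient f"
      "\<lambda>y. (g y, G y)" "\<lambda>y d. (deriv_map g y d, deriv_map G y d)"
    using rad rv lip cont_differentiable_gradient[OF assms(1)] cont_differentiable_gradient[OF assms(2)] dg dG
    by unfold_locales (auto intro!: has_derivative_Pair continuous_Pair)
  have lin: "linear ?Dg" "linear ?DG"
    using dg(1) dG(1) has_derivative_linear by blast+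
  from assms(5) obtain \<rho> where feas: "?z \<in> BP_feasible f g G" and \<rho>: "\<rho> > 0"
    and opt: "\<And>y. y \<in> BP_feasible f g G \<Longrightarrow> dist ?z y < \<rho> \<Longrightarrow> F ?z \<le> F y"
    by (auto simp: BP_local_minimizer_def)
  have feas': "g ?z \<le> 0" "G ?z \<le> 0" "yb \<in> lower_solutions f g xb"
    using feas by (auto simp: BP_feasible_def lower_solutions_def)
  have crit: "ereal (gradient f ?z \<bullet> ?w) \<le> dir_derivative ?V xb u"
    "\<And>i. g ?z $ i = 0 \<Longrightarrow> ?Dg ?w $ i \<le> 0" "\<And>i. G ?z $ i = 0 \<Longrightarrow> ?DG ?w $ i \<le> 0"
    "gradient F ?z \<bullet> ?w \<le> 0"
    using assms(8) by (auto simp: critical_cone_def active_def)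
  have feas_h: "(g ?z, G ?z) \<bullet> b \<le> 0" if "b \<in> Basis" for b
    using that feas'(1,2) by (auto simp: Basis_prod_def Basis_real_vec inner_axis less_eq_vec_def)
  have crit_h: "(?Dg ?w, ?DG ?w) \<bullet> b \<le> 0" if "b \<in> Basis" "(g ?z, G ?z) \<bullet> b = 0" for b
    using that crit(2,3) by (auto simp: Basis_prod_def Basis_real_vec inner_axis)
  have "\<forall>\<^sub>F t in at_right (0::real). t < \<tau>"
    using rad by (intro order_tendstoD[OF tendsto_ident_at]) auto
  then have ev: "\<forall>\<^sub>F t in at_right 0. ?V (xb + t *\<^sub>R u) = ereal (r (xb + t *\<^sub>R u))"
    using eventually_at_right_less[of 0]
    by eventually_elim (use rad in \<open>auto intro!: rv cone_nbhdI\<close>)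
  \<comment> \<open>The value function at \<open>xb\<close> equals \<open>f ?z\<close> because
    \<open>yb\<close> solves the lower level problem.\<close>
  have crit_f: "\<forall>\<^sub>F t in at_right 0. f (?z + t *\<^sub>R ?w) - r (fst (?z + t *\<^sub>R ?w)) \<le> e * t" if "e > 0" for e
    using crit(1) assms(7) ev that value_function_lower_solution[OF feas'(3)]
    by (intro eventually_dir_quotient_bound[OF pen.derivative_f, of ?V]) auto
  \<comment> \<open>Zero violation means that all residual components are nonpositive, so the value
    function reformulation turns \<open>y\<close> into a feasible point of the bilevel
    program.\<close>
  have opt': "F ?z \<le> F y"
    if y: "y \<in> cone_nbhd ?z ?w \<tau> \<eta>" "dist ?z y < \<rho>" "pen.violation 0 y = 0" for y
  proof (rule opt)
    have res: "pen.residual y \<bullet> b \<le> 0" if "b \<in> Basis" for b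
      using y(3) that by (simp add: pen.violation_0 pos_part_eq_0_iff)
    have "f y \<le> r (fst y)"
      using res[of "(1, 0, 0)"] by (simp add: Basis_constraints pen.residual_def)
    moreover have "g y \<le> 0"
      using res[of "(0, axis _ 1, 0)"] by (auto simp: Basis_constraints pen.residual_def inner_axis less_eq_vec_def)
    moreover have "G y \<le> 0"
      using res[of "(0, 0, axis _ 1)"] by (auto simp: Basis_constraints pen.residual_def inner_axis less_eq_vec_def)
    ultimately show "y \<in> BP_feasible f g G"
      using feasible_of_value_function_le[of f g "fst y" "r (fst y)" "snd y" G] rv cone_nbhd_fst[OF y(1)] by simp
  qed fact
  obtain \<epsilon> \<nu> \<xi> t ws where FJ: "0 \<le> \<epsilon>" "\<And>b. b \<in> Basis \<Longrightarrow> 0 \<le> \<nu> \<bullet> b"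
    "\<xi> \<in> dir_limiting_subdiff (\<lambda>a. - ?V a) (fst ?z) (fst ?w)"
    "pen.lagrangian_gradient \<epsilon> \<nu> ?z + fst \<nu> *\<^sub>R (\<xi>, 0) = 0" "\<epsilon> = 0 \<Longrightarrow> norm \<nu> = 1"
    and t: "\<And>k. 0 < t k" "t \<longlonglongrightarrow> (0::real)" and ws: "ws \<longlonglongrightarrow> ?w"
    and inc: "\<And>k::nat. ?z + t k *\<^sub>R ws k \<in> cone_nbhd ?z ?w \<tau> \<eta>"
    and pos: "\<And>k b. b \<in> Basis \<Longrightarrow> \<nu> \<bullet> b > 0 \<Longrightarrow> pen.residual (?z + t k *\<^sub>R ws k) \<bullet> b > 0"
    using pen.Fritz_John_multipliers[OF feas_h crit_h crit_f crit(4) \<rho> opt'] by blast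
  obtain \<alpha> \<mu>g \<mu>G where \<nu>: "\<nu> = (\<alpha>, \<mu>g, \<mu>G)" by (metis prod.exhaust)
  have \<xi>: "\<xi> \<in> dir_limiting_subdiff (\<lambda>a. - ?V a) xb u" using FJ(3) by simp
  have nonneg: "0 \<le> \<alpha>" "0 \<le> \<mu>g" "0 \<le> \<mu>G"
    using FJ(2)[of "(1, 0, 0)"] FJ(2)[of "(0, axis _ 1, 0)"] FJ(2)[of "(0, 0, axis _ 1)"]
    by (simp_all add: Basis_constraints \<nu> inner_axis less_eq_vec_def)
  have eq: "\<epsilon> *\<^sub>R gradient F ?z + \<alpha> *\<^sub>R gradient f ?z + \<alpha> *\<^sub>R (\<xi>, 0) + adjoint ?Dg \<mu>g + adjoint ?DG \<mu>G = 0"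
    using FJ(4) by (simp add: pen.lagrangian_gradient_def \<nu> adjoint_Pair[OF lin] algebra_simps)
  have pos': "f (?z + t k *\<^sub>R ws k) > r (fst (?z + t k *\<^sub>R ws k))" if "\<alpha> > 0" for k
    using pos[of "(1, 0, 0)" k] that by (simp add: Basis_constraints \<nu> pen.residual_def)
  have posg: "g (?z + t k *\<^sub>R ws k) $ i > 0" if "\<mu>g $ i > 0" for k i
    using pos[of "(0, axis i 1, 0)" k] that by (simp add: Basis_constraints \<nu> pen.residual_def inner_axis)
  have posG: "G (?z + t k *\<^sub>R ws k) $ i > 0" if "\<mu>G $ i > 0" for k i
    using pos[of "(0, 0, axis i 1)" k] that by (simp add: Basis_constraints \<nu> pen.residual_def inner_axis)
  \<comment> \<open>A positive multiplier means violation along the whole sequence, so the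
    constraint is active and its derivative along \<open>?w\<close> is 0.\<close>
  have cg: "g ?z $ i = 0 \<and> ?Dg ?w $ i = 0" if "\<mu>g $ i > 0" for i
    using pen.complementarity[of "(axis i 1, 0)", OF _ _ t ws] feas_h[of "(axis i 1, 0)"] crit_h[of "(axis i 1, 0)"] posg[OF that]
    by (simp add: Basis_prod_def Basis_real_vec inner_axis)
  have cG: "G ?z $ i = 0 \<and> ?DG ?w $ i = 0" if "\<mu>G $ i > 0" for i
    using pen.complementarity[of "(0, axis i 1)", OF _ _ t ws] feas_h[of "(0, axis i 1)"] crit_h[of "(0, axis i 1)"] posG[OF that]
    by (simp add: Basis_prod_def Basis_real_vec inner_axis)
  have orth: "orthogonal \<mu>g (g ?z)" "orthogonal \<mu>g (?Dg ?w)" "orthogonal \<mu>G (G ?z)" "orthogonal \<mu>G (?DG ?w)"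
    using nonneg cg cG by (auto intro: orthogonal_vec_nonneg)
  have Clarke: "- \<xi> \<in> dir_Clarke_subdiff ?V xb u"
    using \<xi> by (rule uminus_limiting_subdiff_in_Clarke)
  \<comment> \<open>With weight 0 the normalized multipliers, the Clarke subgradient
    \<open>- \<xi>\<close> and the sequence of violated constraints form exactly the object that
    quasi-normality excludes.\<close>
  have "\<epsilon> \<noteq> 0"
  proof
    assume "\<epsilon> = 0"
    with FJ(5) have "norm \<nu> = 1" by simp
    then have "(\<alpha>, \<mu>g, \<mu>G) \<noteq> 0" using \<nu> by auto
    moreover have "0 \<in> {\<alpha> *\<^sub>R gradient f ?z - \<alpha> *\<^sub>R (\<zeta>, 0) + adjoint ?Dg \<mu>g + adjoint ?DG \<mu>G
        | \<zeta>. \<zeta> \<in> dir_Clarke_subdiff ?V (fst ?z) (fst ?w)}"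
    proof -
      have "\<alpha> *\<^sub>R gradient f ?z - \<alpha> *\<^sub>R (- \<xi>, 0) + adjoint ?Dg \<mu>g + adjoint ?DG \<mu>G = 0"
        using eq \<open>\<epsilon> = 0\<close> by (simp add: prod_eq_iff)
      with Clarke show ?thesis by (auto intro!: exI[of _ "- \<xi>"])
    qed
    moreover have "\<alpha> > 0 \<longrightarrow> ereal \<alpha> * (ereal (f (?z + t k *\<^sub>R ws k)) - ?V (fst (?z + t k *\<^sub>R ws k))) > 0" for k
      using pos'[of k] rv cone_nbhd_fst[OF inc[of k]] by simp
    ultimately show False
      using assms(9) nonneg orth t ws posg posG unfolding dir_quasi_normality_def by blast
  qed
  with FJ(1) have \<epsilon>: "\<epsilon> > 0" by simp
  \<comment> \<open>Dividing by the positive objective weight gives the gradient of \<open>F\<close>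
    coefficient 1.\<close>
  let ?c = "1 / \<epsilon>"
  have scaled: "gradient F ?z + (?c * \<alpha>) *\<^sub>R gradient f ?z + (?c * \<alpha>) *\<^sub>R (\<xi>, 0)
      + adjoint ?Dg (?c *\<^sub>R \<mu>g) + adjoint ?DG (?c *\<^sub>R \<mu>G) = 0"
  proof -
    have "?c *\<^sub>R (\<epsilon> *\<^sub>R gradient F ?z + \<alpha> *\<^sub>R gradient f ?z + \<alpha> *\<^sub>R (\<xi>, 0) + adjoint ?Dg \<mu>g + adjoint ?DG \<mu>G) = 0"
      unfolding eq by simp
    then show ?thesis
      using \<epsilon> by (simp add: scaleR_add_right linear_scale[OF adjoint_linear] lin)
  qed
  have signs: "0 \<le> ?c * \<alpha>" "0 \<le> ?c *\<^sub>R \<mu>g" "0 \<le> ?c *\<^sub>R \<mu>G"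
    using \<epsilon> nonneg by (auto simp: less_eq_vec_def)
  have orth': "orthogonal (?c *\<^sub>R \<mu>g) (g ?z)" "orthogonal (?c *\<^sub>R \<mu>g) (?Dg ?w)"
      "orthogonal (?c *\<^sub>R \<mu>G) (G ?z)" "orthogonal (?c *\<^sub>R \<mu>G) (?DG ?w)"
    using orth by (auto simp: orthogonal_def)
  \<comment> \<open>The same multipliers serve both conclusions: \<open>\<xi>\<close> enters the
    first and \<open>- \<xi>\<close>, with the opposite sign, the second.\<close>
  have scaled': "gradient F ?z + (?c * \<alpha>) *\<^sub>R gradient f ?z - (?c * \<alpha>) *\<^sub>R (- \<xi>, 0)
      + adjoint ?Dg (?c *\<^sub>R \<mu>g) + adjoint ?DG (?c *\<^sub>R \<mu>G) = 0"
    using scaled by (simp add: prod_eq_iff)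
  show ?thesis
  proof (intro conjI)
    show "\<exists>lV lg lG. 0 \<in> {gradient F ?z + lV *\<^sub>R gradient f ?z + lV *\<^sub>R (\<zeta>, 0) + adjoint ?Dg lg + adjoint ?DG lG
             | \<zeta>. \<zeta> \<in> dir_limiting_subdiff (\<lambda>x. - ?V x) xb u} \<and> 0 \<le> lV \<and>
        0 \<le> lg \<and> orthogonal lg (g ?z) \<and> orthogonal lg (?Dg ?w) \<and>
        0 \<le> lG \<and> orthogonal lG (G ?z) \<and> orthogonal lG (?DG ?w)"
      by (rule exI[of _ "?c * \<alpha>"], rule exI[of _ "?c *\<^sub>R \<mu>g"], rule exI[of _ "?c *\<^sub>R \<mu>G"])
         (intro conjI signs orth' CollectI exI[of _ \<xi>] \<xi> scaled[symmetric])
    show "\<exists>lV lg lG. 0 \<in> {gradient F ?z + lV *\<^sub>R gradient f ?z - lV *\<^sub>R (\<zeta>, 0) + adjoint ?Dg lg + adjoint ?DG lG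
             | \<zeta>. \<zeta> \<in> dir_Clarke_subdiff ?V xb u} \<and> 0 \<le> lV \<and>
        0 \<le> lg \<and> orthogonal lg (g ?z) \<and> orthogonal lg (?Dg ?w) \<and>
        0 \<le> lG \<and> orthogonal lG (G ?z) \<and> orthogonal lG (?DG ?w)"
      by (rule exI[of _ "?c * \<alpha>"], rule exI[of _ "?c *\<^sub>R \<mu>g"], rule exI[of _ "?c *\<^sub>R \<mu>G"])
         (intro conjI signs orth' CollectI exI[of _ "- \<xi>"] Clarke scaled'[symmetric])
  qed
qed

end
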